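(* Let $(A,\nwarrow,\nearrow)$ be an $n$-L-dendriform algebra, with horizontal and vertical brackets $\{\cdot,\cdots,\cdot\}^h$, $\{\cdot,\cdots,\cdot\}^v$ and associated $n$-Lie bracket $[\cdot,\cdots,\cdot]^C$. Define $L_\nwarrow,R_\nearrow:\otimes^{n-1}A\to gl(A)$ and $\rho:\wedge^{n-1}A\to gl(A)$ by $$L_\nwarrow(x_1,\dots,x_{n-1})x_n=\nwarrow(x_1,\dots,x_{n-1},x_n),\qquad R_\nearrow(x_1,\dots,x_{n-1})x_n=\nearrow(x_n,x_1,\dots,x_{n-1}),$$ $$\rho(x_1,\dots,x_{n-1})x_n=\nwarrow(x_1,\dots,x_n)+\sum_{i=1}^{n-1}(-1)^i\nearrow(x_n,x_1,\dots,\widehat{x_i},\dots,x_{n-1},x_i)$$ for all $x_i\in A$, and let $L_\nearrow$ be the left multiplication of $\nearrow$, $L_\nearrow(x_1,\dots,x_{n-1})x_n=\nearrow(x_1,\dots,x_{n-1},x_n)$. Then: (1) $(A,L_\nwarrow,R_\nearrow)$ is a representation of the associated horizontal $n$-pre-Lie algebra $(A,\{\cdot,\cdots,\cdot\}^h)$, and $(A,L_\nwarrow,-L_\nearrow)$ is a representation of the associated vertical $n$-pre-Lie algebra $(A,\{\cdot,\cdots,\cdot\}^v)$; (2) $(A,L_\nwarrow)$ is a representation of the associated $n$-Lie algebra $(A,[\cdot,\cdots,\cdot]^C)$; (3) $(A,\rho)$ is a representation of the associated $n$-Lie algebra $(A,[\cdot,\cdots,\cdot]^C)$.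
   Context: $\mathbb K$ is a field of characteristic $0$; all vector spaces are finite dimensional over $\mathbb K$; $n\ge 2$ is an integer; a hat means omission. An $n$-Lie algebra is a vector space $A$ with a skew-symmetric $n$-linear bracket with $[x_1,\dots,x_{n-1},[y_1,\dots,y_n]]=\sum_{i=1}^n[y_1,\dots,y_{i-1},[x_1,\dots,x_{n-1},y_i],y_{i+1},\dots,y_n]$. A representation of it on $V$ is a linear map $\rho:\wedge^{n-1}A\to gl(V)$ with $\rho([x_1,\dots,x_n],y_1,\dots,y_{n-2})=\sum_{i=1}^n(-1)^{n-i}\rho(x_1,\dots,\widehat{x_i},\dots,x_n)\rho(x_i,y_1,\dots,y_{n-2})$ and $[\rho(x_1,\dots,x_{n-1}),\rho(y_1,\dots,y_{n-1})]=\sum_{i=1}^{n-1}\rho(y_1,\dots,y_{i-1},[x_1,\dots,x_{n-1},y_i],y_{i+1},\dots,y_{n-1})$. An $n$-pre-Lie algebra is a vector space $A$ with an $n$-linear map $\{\cdot,\cdots,\cdot\}:(\wedge^{n-1}A)\otimes A\to A$ such that $\{x_1,\dots,x_{n-1},\{y_1,\dots,y_n\}\}=\sum_{i=1}^{n-1}\{y_1,\dots,y_{i-1},[x_1,\dots,x_{n-1},y_i]^C,y_{i+1},\dots,y_n\}+\{y_1,\dots,y_{n-1},\{x_1,\dots,x_{n-1},y_n\}\}$ and $\{[x_1,\dots,x_n]^C,y_1,\dots,y_{n-1}\}=\sum_{i=1}^n(-1)^{n-i}\{x_1,\dots,\widehat{x_i},\dots,x_n,\{x_i,y_1,\dots,y_{n-1}\}\}$,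 where $[x_1,\dots,x_n]^C=\sum_{i=1}^n(-1)^{n-i}\{x_1,\dots,\widehat{x_i},\dots,x_n,x_i\}$; $A^c=(A,[\cdot,\cdots,\cdot]^C)$ is then an $n$-Lie algebra (sub-adjacent). A representation of an $n$-pre-Lie algebra $A$ on $V$ is $(V,l,r)$ with $l:\wedge^{n-1}A\to gl(V)$ a representation of $A^c$ and $r:(\wedge^{n-2}A)\otimes A\to gl(V)$ linear such that, for all $x_i,y_i\in A$, with $\mu(x_1,\dots,x_{n-1})=l(x_1,\dots,x_{n-1})+\sum_{i=1}^{n-1}(-1)^ir(x_1,\dots,\widehat{x_i},\dots,x_{n-1},x_i)$: (R1) $l(x_1,\dots,x_{n-1})r(y_1,\dots,y_{n-1})=r(y_1,\dots,y_{n-1})\mu(x_1,\dots,x_{n-1})+\sum_{i=1}^{n-2}r(y_1,\dots,y_{i-1},[x_1,\dots,x_{n-1},y_i]^C,y_{i+1},\dots,y_{n-1})+r(y_1,\dots,y_{n-2},\{x_1,\dots,x_{n-1},y_{n-1}\})$; (R2) $r([x_1,\dots,x_n]^C,y_1,\dots,y_{n-2})=\sum_{i=1}^n(-1)^{n-i}l(x_1,\dots,\widehat{x_i},\dots,x_n)r(x_i,y_1,\dots,y_{n-2})$; (R3) $r(x_1,\dots,x_{n-2},\{y_1,\dots,y_n\})=l(y_1,\dots,y_{n-1})r(x_1,\dots,x_{n-2},y_n)+\sum_{i=1}^{n-1}(-1)^{i+1}r(y_1,\dots,\widehat{y_i},\dots,y_n)\mu(x_1,\dots,x_{n-2},y_i)$;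 (R4) $r(y_1,\dots,y_{n-1})\mu(x_1,\dots,x_{n-1})=l(x_1,\dots,x_{n-1})r(y_1,\dots,y_{n-1})+\sum_{i=1}^{n-1}(-1)^ir(x_1,\dots,\widehat{x_i},\dots,x_{n-1},\{x_i,y_1,\dots,y_{n-1}\})$. An $n$-L-dendriform algebra is a vector space $A$ with $n$-linear maps $\nwarrow:(\wedge^{n-1}A)\otimes A\to A$ and $\nearrow:A\otimes(\wedge^{n-2}A)\otimes A\to A$ such that, for all $x_i,y_i\in A$, with $\{x_1,\dots,x_n\}^h=\nwarrow(x_1,\dots,x_n)+\sum_{i=1}^{n-1}(-1)^{i+1}\nearrow(x_i,x_1,\dots,\widehat{x_i},\dots,x_n)$ (horizontal bracket), $\{x_1,\dots,x_n\}^v=\nwarrow(x_1,\dots,x_n)+\sum_{i=1}^{n-1}(-1)^i\nearrow(x_n,x_1,\dots,\widehat{x_i},\dots,x_{n-1},x_i)$ (vertical bracket), $[x_1,\dots,x_n]^C=\sum_{i=1}^n(-1)^{n-i}\{x_1,\dots,\widehat{x_i},\dots,x_n,x_i\}^h=\sum_{i=1}^n(-1)^{n-i}\{x_1,\dots,\widehat{x_i},\dots,x_n,x_i\}^v$: (D1) $\nwarrow(x_1,\dots,x_{n-1},\nwarrow(y_1,\dots,y_n))-\nwarrow(y_1,\dots,y_{n-1},\nwarrow(x_1,\dots,x_{n-1},y_n))=\sum_{i=1}^{n-1}\nwarrow(y_1,\dots,y_{i-1},[x_1,\dots,x_{n-1},y_i]^C,y_{i+1},\dots,y_n)$; (D2)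 $\nwarrow([x_1,\dots,x_n]^C,y_1,\dots,y_{n-1})=\sum_{i=1}^n(-1)^{n-i}\nwarrow(x_1,\dots,\widehat{x_i},\dots,x_n,\nwarrow(x_i,y_1,\dots,y_{n-1}))$; (D3) $\nwarrow(x_1,\dots,x_{n-1},\nearrow(y_n,y_1,\dots,y_{n-1}))-\nearrow(y_n,y_1,\dots,y_{n-2},\{x_1,\dots,x_{n-1},y_{n-1}\}^h)=\nearrow(\{x_1,\dots,x_{n-1},y_n\}^v,y_1,\dots,y_{n-1})+\sum_{i=1}^{n-2}\nearrow(y_n,y_1,\dots,y_{i-1},[x_1,\dots,x_{n-1},y_i]^C,y_{i+1},\dots,y_{n-1})$; (D4) $\nearrow(y_{n-1},[x_1,\dots,x_n]^C,y_1,\dots,y_{n-2})=\sum_{i=1}^n(-1)^{n-i}\nwarrow(x_1,\dots,\widehat{x_i},\dots,x_n,\nearrow(y_{n-1},x_i,y_1,\dots,y_{n-2}))$; (D5) $\nearrow(x_{n-1},x_1,\dots,x_{n-2},\{y_1,\dots,y_n\}^h)-\nwarrow(y_1,\dots,y_{n-1},\nearrow(x_{n-1},x_1,\dots,x_{n-2},y_n))=\sum_{i=1}^{n-1}(-1)^{i+1}\nearrow(\{x_1,\dots,x_{n-2},y_i,x_{n-1}\}^v,y_1,\dots,\widehat{y_i},\dots,y_n)$; (D6) $\nearrow(\{x_1,\dots,x_{n-1},y_n\}^v,y_1,\dots,y_{n-1})-\nwarrow(x_1,\dots,x_{n-1},\nearrow(y_n,y_1,\dots,y_{n-1}))=\sum_{i=1}^{n-1}(-1)^i\nearrow(y_n,x_1,\dots,\widehat{x_i},\dots,x_{n-1},\{x_i,y_1,\dots,y_{n-1}\}^h)$.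 The paper takes $(A,\{\cdot,\cdots,\cdot\}^h)$ and $(A,\{\cdot,\cdots,\cdot\}^v)$ to be $n$-pre-Lie algebras (the associated horizontal and vertical ones) with common sub-adjacent $n$-Lie algebra $(A,[\cdot,\cdots,\cdot]^C)$ (the associated $n$-Lie algebra).
   Formalization: For even n the signs (-1)^{i+1} in (R3) and (D5) are corrected to (-1)^{n+i}; for n=2 conditions (R2) and (D4) are dropped; -L_↗ is read as (x_1,…,x_{n-1}) ↦ -L_↗(x_{n-1},x_1,…,x_{n-2}). As printed, (1) fails at n=2. *)

theory Defs
  imports Complex_Main
begin

text \<open>
  Conventions. The vector spaces are whole types with an explicit scalar multiplication \<open>s\<close>.
  The argument tuple \<open>(x\<^sub>1, \<dots>, x\<^sub>m)\<close> of an \<open>m\<close>-linear map is a list of length \<open>m\<close>; the values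
  of such a map on lists of any other length are irrelevant. Lists are indexed from \<open>0\<close>, so the
  index \<open>i\<close> below is the mathematical index minus one and the signs are shifted accordingly:
  \<open>(-1)\<^bsup>n-i\<^esup>\<close> becomes \<open>(-1) ^ (n - Suc i)\<close>. Operator identities in \<open>gl(V)\<close> are stated by evaluating
  both sides at an arbitrary vector \<open>v\<close>.
\<close>

definition omit :: "nat \<Rightarrow> 'b list \<Rightarrow> 'b list" where
  "omit i xs = take i xs @ drop (Suc i) xs"

definition multilinear ::
  "('k::field \<Rightarrow> 'a::ab_group_add \<Rightarrow> 'a) \<Rightarrow> ('k \<Rightarrow> 'b::ab_group_add \<Rightarrow> 'b) \<Rightarrow> nat \<Rightarrow> ('a list \<Rightarrow> 'b) \<Rightarrow> bool"
where
  "multilinear sA sB m f \<longleftrightarrow>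
     (\<forall>xs. length xs = m \<longrightarrow> (\<forall>i<m. Vector_Spaces.linear sA sB (\<lambda>a. f (xs[i := a]))))"

text \<open>Skew-symmetry in the argument positions belonging to \<open>I\<close>.\<close>

definition skew_in :: "nat set \<Rightarrow> nat \<Rightarrow> ('a list \<Rightarrow> 'b::ab_group_add) \<Rightarrow> bool" where
  "skew_in I m f \<longleftrightarrow>
     (\<forall>xs. length xs = m \<longrightarrow>
        (\<forall>i\<in>I. \<forall>j\<in>I. i \<noteq> j \<longrightarrow> f (xs[i := xs ! j, j := xs ! i]) = - f xs))"

text \<open>An \<open>m\<close>-linear map from \<open>A\<close> to \<open>gl(V)\<close>, skew-symmetric in the positions belonging to \<open>I\<close>.\<close>

definition skew_operator_map ::
  "('k::field \<Rightarrow> 'a::ab_group_add \<Rightarrow> 'a) \<Rightarrow> ('k \<Rightarrow> 'v::ab_group_add \<Rightarrow> 'v) \<Rightarrow> nat set \<Rightarrow> nat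
    \<Rightarrow> ('a list \<Rightarrow> 'v \<Rightarrow> 'v) \<Rightarrow> bool"
where
  "skew_operator_map sA sV I m f \<longleftrightarrow>
     (\<forall>xs. length xs = m \<longrightarrow> Vector_Spaces.linear sV sV (f xs)) \<and>
     (\<forall>v. multilinear sA sV m (\<lambda>xs. f xs v)) \<and>
     (\<forall>v. skew_in I m (\<lambda>xs. f xs v))"


section \<open>n-Lie algebras\<close>

definition n_lie :: "nat \<Rightarrow> ('k::field \<Rightarrow> 'a::ab_group_add \<Rightarrow> 'a) \<Rightarrow> ('a list \<Rightarrow> 'a) \<Rightarrow> bool" where
  "n_lie n s br \<longleftrightarrow>
     multilinear s s n br \<and> skew_in {..<n} n br \<and>
     (\<forall>xs ys. length xs = n - 1 \<longrightarrow> length ys = n \<longrightarrow>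
        br (xs @ [br ys]) = (\<Sum>i<n. br (ys[i := br (xs @ [ys ! i])])))"

definition n_lie_rep ::
  "nat \<Rightarrow> ('k::field \<Rightarrow> 'a::ab_group_add \<Rightarrow> 'a) \<Rightarrow> ('a list \<Rightarrow> 'a)
    \<Rightarrow> ('k \<Rightarrow> 'v::ab_group_add \<Rightarrow> 'v) \<Rightarrow> ('a list \<Rightarrow> 'v \<Rightarrow> 'v) \<Rightarrow> bool"
where
  "n_lie_rep n sA br sV \<rho> \<longleftrightarrow>
     n_lie n sA br \<and>
     skew_operator_map sA sV {..<n - 1} (n - 1) \<rho> \<and>
     (\<forall>xs ys v. length xs = n \<longrightarrow> length ys = n - 2 \<longrightarrow>
        \<rho> (br xs # ys) v =
          (\<Sum>i<n. sV ((-1) ^ (n - Suc i)) (\<rho> (omit i xs) (\<rho> (xs ! i # ys) v)))) \<and>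
     (\<forall>xs ys v. length xs = n - 1 \<longrightarrow> length ys = n - 1 \<longrightarrow>
        \<rho> xs (\<rho> ys v) - \<rho> ys (\<rho> xs v) =
          (\<Sum>i<n - 1. \<rho> (ys[i := br (xs @ [ys ! i])]) v))"


section \<open>n-pre-Lie algebras\<close>

text \<open>The sub-adjacent bracket \<open>[x\<^sub>1, \<dots>, x\<^sub>n]\<^sup>C\<close>.\<close>

definition sub_adjacent ::
  "nat \<Rightarrow> ('k::field \<Rightarrow> 'a::ab_group_add \<Rightarrow> 'a) \<Rightarrow> ('a list \<Rightarrow> 'a) \<Rightarrow> 'a list \<Rightarrow> 'a"
where
  "sub_adjacent n s br xs =
     (\<Sum>i<n. s ((-1) ^ (n - Suc i)) (br (omit i xs @ [xs ! i])))"

definition n_pre_lie :: "nat \<Rightarrow> ('k::field \<Rightarrow> 'a::ab_group_add \<Rightarrow> 'a) \<Rightarrow> ('a list \<Rightarrow> 'a) \<Rightarrow> bool" where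
  "n_pre_lie n s br \<longleftrightarrow>
     multilinear s s n br \<and> skew_in {..<n - 1} n br \<and>
     (\<forall>xs ys. length xs = n - 1 \<longrightarrow> length ys = n \<longrightarrow>
        br (xs @ [br ys]) =
          (\<Sum>i<n - 1. br (ys[i := sub_adjacent n s br (xs @ [ys ! i])]))
          + br (butlast ys @ [br (xs @ [last ys])])) \<and>
     (\<forall>xs ys. length xs = n \<longrightarrow> length ys = n - 1 \<longrightarrow>
        br (sub_adjacent n s br xs # ys) =
          (\<Sum>i<n. s ((-1) ^ (n - Suc i)) (br (omit i xs @ [br (xs ! i # ys)]))))"

definition pre_lie_mu ::
  "nat \<Rightarrow> ('k::field \<Rightarrow> 'v::ab_group_add \<Rightarrow> 'v) \<Rightarrow> ('a list \<Rightarrow> 'v \<Rightarrow> 'v) \<Rightarrow> ('a list \<Rightarrow> 'v \<Rightarrow> 'v)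
    \<Rightarrow> 'a list \<Rightarrow> 'v \<Rightarrow> 'v"
where
  "pre_lie_mu n sV l r xs v =
     l xs v + (\<Sum>i<n - 1. sV ((-1) ^ Suc i) (r (omit i xs @ [xs ! i]) v))"

text \<open>
  Representations \<open>(V, l, r)\<close> of an \<open>n\<close>-pre-Lie algebra. The conditions on \<open>l\<close> and \<open>r\<close> express that
  the semidirect product on \<open>A \<oplus> V\<close> with \<open>{x\<^sub>1, \<dots>, x\<^sub>n\<^sub>-\<^sub>1, v} = l(x\<^sub>1, \<dots>, x\<^sub>n\<^sub>-\<^sub>1) v\<close> and
  \<open>{v, x\<^sub>1, \<dots>, x\<^sub>n\<^sub>-\<^sub>1} = r(x\<^sub>1, \<dots>, x\<^sub>n\<^sub>-\<^sub>1) v\<close> is again an \<open>n\<close>-pre-Lie algebra. Two points follow from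
  this:

  \<^item> In the condition on \<open>r(x\<^sub>1, \<dots>, x\<^sub>n\<^sub>-\<^sub>2, {y\<^sub>1, \<dots>, y\<^sub>n})\<close> the sign of the \<open>i\<close>-th summand (counting
    from 1) is \<open>(-1)\<^bsup>n+i\<^esup>\<close>, because moving \<open>v\<close> to the front past \<open>n - 2\<close> skew arguments contributes
    \<open>(-1)\<^sup>n\<close>. For odd \<open>n\<close> this is the sign \<open>(-1)\<^bsup>i+1\<^esup>\<close> found in the literature; for even \<open>n\<close> the latter
    is a misprint, refuted at \<open>n = 2\<close> by the regular representation of a pre-Lie algebra.

  \<^item> In the condition on \<open>r([x\<^sub>1, \<dots>, x\<^sub>n]\<^sup>C, y\<^sub>1, \<dots>, y\<^sub>n\<^sub>-\<^sub>2)\<close> the bracket is one of the \<open>n - 2\<close> skew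
    arguments of \<open>r\<close>, so the condition is void for \<open>n = 2\<close>.

  With this, the case \<open>n = 2\<close> is the usual notion of a bimodule over a (left) pre-Lie algebra.
\<close>

definition n_pre_lie_rep ::
  "nat \<Rightarrow> ('k::field \<Rightarrow> 'a::ab_group_add \<Rightarrow> 'a) \<Rightarrow> ('a list \<Rightarrow> 'a)
    \<Rightarrow> ('k \<Rightarrow> 'v::ab_group_add \<Rightarrow> 'v) \<Rightarrow> ('a list \<Rightarrow> 'v \<Rightarrow> 'v) \<Rightarrow> ('a list \<Rightarrow> 'v \<Rightarrow> 'v) \<Rightarrow> bool"
where
  "n_pre_lie_rep n sA br sV l r \<longleftrightarrow>
     n_pre_lie n sA br \<and>
     n_lie_rep n sA (sub_adjacent n sA br) sV l \<and>
     skew_operator_map sA sV {..<n - 2} (n - 1) r \<and>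
     (\<forall>xs ys v. length xs = n - 1 \<longrightarrow> length ys = n - 1 \<longrightarrow>
        l xs (r ys v) =
          r ys (pre_lie_mu n sV l r xs v)
          + (\<Sum>i<n - 2. r (ys[i := sub_adjacent n sA br (xs @ [ys ! i])]) v)
          + r (butlast ys @ [br (xs @ [last ys])]) v) \<and>
     (n \<ge> 3 \<longrightarrow> (\<forall>xs ys v. length xs = n \<longrightarrow> length ys = n - 2 \<longrightarrow>
        r (sub_adjacent n sA br xs # ys) v =
          (\<Sum>i<n. sV ((-1) ^ (n - Suc i)) (l (omit i xs) (r (xs ! i # ys) v))))) \<and>
     (\<forall>xs ys v. length xs = n - 2 \<longrightarrow> length ys = n \<longrightarrow>
        r (xs @ [br ys]) v =
          l (butlast ys) (r (xs @ [last ys]) v)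
          + (\<Sum>i<n - 1. sV ((-1) ^ (n + Suc i))
               (r (omit i ys) (pre_lie_mu n sV l r (xs @ [ys ! i]) v)))) \<and>
     (\<forall>xs ys v. length xs = n - 1 \<longrightarrow> length ys = n - 1 \<longrightarrow>
        r ys (pre_lie_mu n sV l r xs v) =
          l xs (r ys v)
          + (\<Sum>i<n - 1. sV ((-1) ^ Suc i) (r (omit i xs @ [br (xs ! i # ys)]) v)))"


section \<open>n-L-dendriform algebras\<close>

definition horizontal ::
  "nat \<Rightarrow> ('k::field \<Rightarrow> 'a::ab_group_add \<Rightarrow> 'a) \<Rightarrow> ('a list \<Rightarrow> 'a) \<Rightarrow> ('a list \<Rightarrow> 'a) \<Rightarrow> 'a list \<Rightarrow> 'a"
where
  "horizontal n s NW NE xs =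
     NW xs + (\<Sum>i<n - 1. s ((-1) ^ i) (NE (xs ! i # omit i xs)))"

definition vertical ::
  "nat \<Rightarrow> ('k::field \<Rightarrow> 'a::ab_group_add \<Rightarrow> 'a) \<Rightarrow> ('a list \<Rightarrow> 'a) \<Rightarrow> ('a list \<Rightarrow> 'a) \<Rightarrow> 'a list \<Rightarrow> 'a"
where
  "vertical n s NW NE xs =
     NW xs + (\<Sum>i<n - 1. s ((-1) ^ Suc i) (NE (last xs # omit i (butlast xs) @ [xs ! i])))"

text \<open>
  The horizontal and the vertical bracket have the same sub-adjacent bracket, by the skew-symmetry
  of the two operations; it is written here by means of the horizontal one.
\<close>

definition dend_comm ::
  "nat \<Rightarrow> ('k::field \<Rightarrow> 'a::ab_group_add \<Rightarrow> 'a) \<Rightarrow> ('a list \<Rightarrow> 'a) \<Rightarrow> ('a list \<Rightarrow> 'a) \<Rightarrow> 'a list \<Rightarrow> 'a"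
where
  "dend_comm n s NW NE = sub_adjacent n s (horizontal n s NW NE)"

text \<open>
  The last six conjuncts are the axioms. The fourth and fifth are the counterparts of the two
  conditions discussed for representations: the fourth, whose bracket occupies one of the \<open>n - 2\<close>
  skew arguments of \<open>\<nearrow>\<close>, is void for \<open>n = 2\<close>, and the signs in the fifth are \<open>(-1)\<^bsup>n+i\<^esup>\<close>, which is
  \<open>(-1)\<^bsup>i+1\<^esup>\<close> for odd \<open>n\<close>. For \<open>n = 2\<close> this is the usual notion of an L-dendriform algebra.
\<close>

definition n_L_dendriform ::
  "nat \<Rightarrow> ('k::field \<Rightarrow> 'a::ab_group_add \<Rightarrow> 'a) \<Rightarrow> ('a list \<Rightarrow> 'a) \<Rightarrow> ('a list \<Rightarrow> 'a) \<Rightarrow> bool"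
where
  "n_L_dendriform n s NW NE \<longleftrightarrow>
     multilinear s s n NW \<and> skew_in {..<n - 1} n NW \<and>
     multilinear s s n NE \<and> skew_in {1..<n - 1} n NE \<and>
     (\<forall>xs ys. length xs = n - 1 \<longrightarrow> length ys = n \<longrightarrow>
        NW (xs @ [NW ys]) - NW (butlast ys @ [NW (xs @ [last ys])]) =
          (\<Sum>i<n - 1. NW (ys[i := dend_comm n s NW NE (xs @ [ys ! i])]))) \<and>
     (\<forall>xs ys. length xs = n \<longrightarrow> length ys = n - 1 \<longrightarrow>
        NW (dend_comm n s NW NE xs # ys) =
          (\<Sum>i<n. s ((-1) ^ (n - Suc i)) (NW (omit i xs @ [NW (xs ! i # ys)])))) \<and>
     (\<forall>xs ys z. length xs = n - 1 \<longrightarrow> length ys = n - 1 \<longrightarrow>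
        NW (xs @ [NE (z # ys)])
          - NE (z # butlast ys @ [horizontal n s NW NE (xs @ [last ys])]) =
          NE (vertical n s NW NE (xs @ [z]) # ys)
          + (\<Sum>i<n - 2. NE (z # ys[i := dend_comm n s NW NE (xs @ [ys ! i])]))) \<and>
     (n \<ge> 3 \<longrightarrow> (\<forall>xs ys z. length xs = n \<longrightarrow> length ys = n - 2 \<longrightarrow>
        NE (z # dend_comm n s NW NE xs # ys) =
          (\<Sum>i<n. s ((-1) ^ (n - Suc i)) (NW (omit i xs @ [NE (z # xs ! i # ys)]))))) \<and>
     (\<forall>xs ys z. length xs = n - 2 \<longrightarrow> length ys = n \<longrightarrow>
        NE (z # xs @ [horizontal n s NW NE ys])
          - NW (butlast ys @ [NE (z # xs @ [last ys])]) =
          (\<Sum>i<n - 1. s ((-1) ^ (n + Suc i))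
             (NE (vertical n s NW NE (xs @ [ys ! i, z]) # omit i ys)))) \<and>
     (\<forall>xs ys z. length xs = n - 1 \<longrightarrow> length ys = n - 1 \<longrightarrow>
        NE (vertical n s NW NE (xs @ [z]) # ys) - NW (xs @ [NE (z # ys)]) =
          (\<Sum>i<n - 1. s ((-1) ^ Suc i)
             (NE (z # omit i xs @ [horizontal n s NW NE (xs ! i # ys)]))))"

definition left_mult :: "('a list \<Rightarrow> 'a) \<Rightarrow> 'a list \<Rightarrow> 'a \<Rightarrow> 'a" where
  "left_mult f xs v = f (xs @ [v])"

definition right_mult :: "('a list \<Rightarrow> 'a) \<Rightarrow> 'a list \<Rightarrow> 'a \<Rightarrow> 'a" where
  "right_mult f xs v = f (v # xs)"

text \<open>
  The canonical isomorphism from \<open>\<Lambda>\<^bsup>n-2\<^esup>A \<otimes> A\<close> to \<open>A \<otimes> \<Lambda>\<^bsup>n-2\<^esup>A\<close> on argument lists. The left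
  multiplication of \<open>\<nearrow>\<close> is defined on \<open>A \<otimes> \<Lambda>\<^bsup>n-2\<^esup>A\<close>, whereas the right action of a representation
  is defined on \<open>\<Lambda>\<^bsup>n-2\<^esup>A \<otimes> A\<close>.
\<close>

definition last_to_front :: "'a list \<Rightarrow> 'a list" where
  "last_to_front xs = last xs # butlast xs"

definition dend_rho ::
  "nat \<Rightarrow> ('k::field \<Rightarrow> 'a::ab_group_add \<Rightarrow> 'a) \<Rightarrow> ('a list \<Rightarrow> 'a) \<Rightarrow> ('a list \<Rightarrow> 'a)
    \<Rightarrow> 'a list \<Rightarrow> 'a \<Rightarrow> 'a"
where
  "dend_rho n s NW NE xs v =
     NW (xs @ [v]) + (\<Sum>i<n - 1. s ((-1) ^ Suc i) (NE (v # omit i xs @ [xs ! i])))"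

end

theory Submission
  imports Defs
begin

text \<open>
  The conditions on \<open>(L\<^sub>\<nwarrow>, R\<^sub>\<nearrow>)\<close> and \<open>(L\<^sub>\<nwarrow>, -L\<^sub>\<nearrow>)\<close> are the axioms of an \<open>n\<close>-L-dendriform algebra read as
  operator identities, because \<open>\<mu>\<close> is the left multiplication of the vertical bracket in the first
  case and of the horizontal bracket in the second one. What needs work is that the two brackets are
  \<open>n\<close>-pre-Lie. Numbering the six axioms (D1)--(D6) in the order of their definition, the first
  pre-Lie identity of the horizontal (vertical) bracket is the sum of (D1), (D3) and (D5) (resp. (D6)),
  and the second one is the sum of (D2), (D4) and (D6) (resp. (D5)). The terms that remain cancel
  because the sub-adjacent bracket can be expanded in either bracket, and because an alternating
  double sum over two omitted entries is antisymmetric in the order of omission. Finally, \<open>\<rho>\<close> is the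
  left multiplication of the vertical bracket, and the left multiplication of an \<open>n\<close>-pre-Lie algebra
  represents its sub-adjacent \<open>n\<close>-Lie algebra.
\<close>

subsection \<open>Signs\<close>

text \<open>The factor (-1)^k acting on an abelian group. No scalars occur, so sign bookkeeping
  reduces to comparing parities, which is what \<open>signed_cong\<close> does.\<close>

definition signed :: "nat \<Rightarrow> 'b::ab_group_add \<Rightarrow> 'b" where
  "signed k v = (if even k then v else - v)"

lemma signed_0 [simp]: "signed 0 v = v"
  by (simp add: signed_def)

lemma signed_Suc: "signed (Suc k) v = - signed k v"
  by (simp add: signed_def)

lemma signed_signed [simp]: "signed j (signed k v) = signed (j + k) v"
  by (auto simp: signed_def)

lemma signed_minus: "signed k (- v) = - signed k v"
  by (simp add: signed_def)

lemma signed_plus: "signed k (v + w) = signed k v + signed k w"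
  by (simp add: signed_def)

lemma signed_sum: "signed k (sum f A) = (\<Sum>i\<in>A. signed k (f i))"
  by (simp add: signed_def sum_negf)

lemma signed_cong: "even (j + k) \<Longrightarrow> v = w \<Longrightarrow> signed j v = signed k w"
  by (auto simp: signed_def)

lemma (in vector_space) scale_neg_one_power: "scale ((-1) ^ k) v = signed k v"
  by (simp add: signed_def)

lemma linear_signed:
  assumes "Vector_Spaces.linear s1 s2 f"
  shows "f (signed k v) = signed k (f v)"
proof -
  interpret Vector_Spaces.linear s1 s2 f by fact
  show ?thesis by (simp add: signed_def neg)
qed

lemma linear_signed_sum:
  assumes "Vector_Spaces.linear s1 s2 f"
  shows "f (\<Sum>i\<in>A. signed (k i) (g i)) = (\<Sum>i\<in>A. signed (k i) (f (g i)))"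
proof -
  interpret Vector_Spaces.linear s1 s2 f by fact
  show ?thesis by (simp add: sum linear_signed[OF assms])
qed


subsection \<open>Omitting list entries\<close>

lemma length_omit [simp]: "i < length xs \<Longrightarrow> length (omit i xs) = length xs - 1"
  by (simp add: omit_def)

lemma omit_Cons_0 [simp]: "omit 0 (x # xs) = xs"
  by (simp add: omit_def)

lemma omit_Cons_Suc [simp]: "omit (Suc i) (x # xs) = x # omit i xs"
  by (simp add: omit_def)

lemma omit_append [simp]: "i < length xs \<Longrightarrow> omit i (xs @ ys) = omit i xs @ ys"
  by (simp add: omit_def)

lemma omit_append_length [simp]: "omit (length xs) (xs @ y # ys) = xs @ ys"
  by (simp add: omit_def)

lemma omit_append_Suc [simp]: "omit (Suc (length xs + i)) (xs @ y # ys) = xs @ y # omit i ys"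
  by (simp add: omit_def)

lemma omit_butlast: "Suc i < length xs \<Longrightarrow> omit i (butlast xs) = butlast (omit i xs)"
  by (simp add: omit_def butlast_append butlast_drop take_butlast)

lemma nth_omit:
  "i < length xs \<Longrightarrow> k < length xs - 1 \<Longrightarrow> omit i xs ! k = xs ! (if k < i then k else Suc k)"
  by (auto simp: omit_def nth_append min_def)

lemma last_omit: "Suc i < length xs \<Longrightarrow> last (omit i xs) = last xs"
  by (simp add: omit_def last_append)

text \<open>The simplicial face identity: once entry \<open>i\<close> is gone, a later entry has its
  index lowered by one.\<close>

lemma omit_omit:
  assumes "i \<le> k" and "Suc k < length xs"
  shows "omit k (omit i xs) = omit i (omit (Suc k) xs)"
  using assms by (intro nth_equalityI) (auto simp: nth_omit)

lemma omit_update: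
  "i < length xs \<Longrightarrow> k < length xs - 1 \<Longrightarrow>
    (omit i xs)[k := a] = omit i (xs[(if k < i then k else Suc k) := a])"
  by (intro nth_equalityI) (auto simp: nth_omit nth_list_update)

lemma omit_update_same: "omit i (xs[i := a]) = omit i xs"
  by (simp add: omit_def)

text \<open>Deleting the entries \<open>i\<close> and then \<open>k\<close> is the same as deleting the same two entries in the
  other order; this is an involution on the pairs \<open>(i, k)\<close> which changes the parity of \<open>i + k\<close>.\<close>

lemma sum_omit_omit_swap:
  fixes F :: "'a \<Rightarrow> 'a \<Rightarrow> 'a list \<Rightarrow> 'b::ab_group_add"
  assumes "length xs = n"
  shows "(\<Sum>i<n. \<Sum>k<n - 1. signed (i + k) (F (omit i xs ! k) (xs ! i) (omit k (omit i xs))))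
    = - (\<Sum>i<n. \<Sum>k<n - 1. signed (i + k) (F (xs ! i) (omit i xs ! k) (omit k (omit i xs))))"
proof -
  \<comment> \<open>The second index counts positions after the first deletion, so it stands for the
    original entry \<open>k\<close> if \<open>k < i\<close> and for \<open>Suc k\<close> otherwise.
    Exchanging the two original entries gives this map. It is its own inverse and hence serves as
    both witnesses of the reindexing.\<close>
  let ?\<tau> = "\<lambda>(i, k). if k < i then (k, i - 1) else (Suc k, i)"
  have "(\<Sum>(i, k)\<in>{..<n} \<times> {..<n - 1}.
          signed (i + k) (F (omit i xs ! k) (xs ! i) (omit k (omit i xs))))
      = (\<Sum>(i, k)\<in>{..<n} \<times> {..<n - 1}.
          - signed (i + k) (F (xs ! i) (omit i xs ! k) (omit k (omit i xs))))"
  proof (rule sum.reindex_bij_witness[where i = ?\<tau> and j = ?\<tau>])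
    fix p assume p: "p \<in> {..<n} \<times> {..<n - 1}"
    obtain i k where [simp]: "p = (i, k)" by (cases p)
    have ik: "i < n" "k < n - 1" using p by auto
    show "(case ?\<tau> p of (i, k) \<Rightarrow> - signed (i + k) (F (xs ! i) (omit i xs ! k) (omit k (omit i xs))))
      = (case p of (i, k) \<Rightarrow> signed (i + k) (F (omit i xs ! k) (xs ! i) (omit k (omit i xs))))"
    proof (cases "k < i")
      case True
      then show ?thesis
        using ik assms omit_omit[of k "i - 1" xs]
        by (auto simp: nth_omit signed_Suc[symmetric] intro!: signed_cong)
    next
      case False
      then show ?thesis
        using ik assms omit_omit[of i k xs]
        by (auto simp: nth_omit signed_Suc[symmetric] intro!: signed_cong)
    qed
  qed (auto split: if_splits)
  then show ?thesis
    by (simp add: sum.cartesian_product sum_negf case_prod_unfold)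
qed

text \<open>For \<open>i < n\<close> the number \<open>n - Suc i\<close> has the parity of
  \<open>n - 1 + i\<close>, so a common sign factors out of \<open>sum_omit_omit_swap\<close>. The
  minus sign is absorbed by replacing \<open>k\<close> with \<open>Suc k\<close>.\<close>

lemma sum_omit_omit_swap_signed:
  fixes F :: "'a \<Rightarrow> 'a \<Rightarrow> 'a list \<Rightarrow> 'b::ab_group_add"
  assumes "length xs = n"
  shows "(\<Sum>i<n. \<Sum>k<n - 1. signed (n - Suc i + k) (F (omit i xs ! k) (xs ! i) (omit k (omit i xs))))
    = (\<Sum>i<n. \<Sum>k<n - 1. signed (n - Suc i + Suc k) (F (xs ! i) (omit i xs ! k) (omit k (omit i xs))))"
proof -
  have eq: "(\<Sum>i<n. \<Sum>k<n - 1. signed (n - Suc i + l k) (G i k))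
      = signed (n - 1) (\<Sum>i<n. \<Sum>k<n - 1. signed (i + l k) (G i k))"
    for l :: "nat \<Rightarrow> nat" and G :: "nat \<Rightarrow> nat \<Rightarrow> 'b"
    by (auto simp: signed_sum intro!: sum.cong signed_cong)
  show ?thesis
    unfolding eq using sum_omit_omit_swap[OF assms, of F]
    by (simp add: signed_Suc sum_negf)
qed

text \<open>Leibniz rule: the replaced entry is either the distinguished one, \<open>j\<close>, or one of the others.\<close>

lemma sum_update_omit:
  fixes G :: "nat \<Rightarrow> 'a \<Rightarrow> 'a list \<Rightarrow> 'b::ab_group_add"
  assumes "m \<le> length ys"
  shows "(\<Sum>i<m. \<Sum>j<m. G j (ys[i := c (ys ! i)] ! j) (omit j (ys[i := c (ys ! i)])))
    = (\<Sum>i<m. G i (c (ys ! i)) (omit i ys))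
      + (\<Sum>j<m. \<Sum>i<m - 1. G j (ys ! j) ((omit j ys)[i := c (omit j ys ! i)]))"
proof -
  have "(\<Sum>i<m. G j (ys[i := c (ys ! i)] ! j) (omit j (ys[i := c (ys ! i)])))
      = G j (c (ys ! j)) (omit j ys)
        + (\<Sum>i<m - 1. G j (ys ! j) ((omit j ys)[i := c (omit j ys ! i)]))" if j: "j < m" for j
  proof -
    let ?f = "\<lambda>i. G j (ys[i := c (ys ! i)] ! j) (omit j (ys[i := c (ys ! i)]))"
    have "sum ?f {..<m} = ?f j + sum ?f ({..<m} - {j})"
      using j by (simp add: sum.remove)
    \<comment> \<open>The indices other than \<open>j\<close> are enumerated by positions in
      \<open>omit j ys\<close>, skipping the gap at \<open>j\<close>.\<close>
    also have "sum ?f ({..<m} - {j}) = (\<Sum>i<m - 1. ?f (if i < j then i else Suc i))"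
      by (rule sum.reindex_bij_witness[where j = "\<lambda>i. if i < j then i else i - 1"
            and i = "\<lambda>i. if i < j then i else Suc i"]) (use j in auto)
    also have "\<dots> = (\<Sum>i<m - 1. G j (ys ! j) ((omit j ys)[i := c (omit j ys ! i)]))"
      using j assms by (intro sum.cong refl) (auto simp: omit_update nth_omit)
    finally show ?thesis using j assms by (simp add: omit_update_same)
  qed
  then show ?thesis
    by (subst sum.swap) (simp add: sum.distrib)
qed


subsection \<open>Skew-symmetry\<close>

lemma skew_in_adjacentD:
  assumes "skew_in I m f" and "length as \<in> I" and "Suc (length as) \<in> I"
    and "length as + length bs + 2 = m"
  shows "f (as @ x # y # bs) = - f (as @ y # x # bs)"
  using assms(2-) assms(1)[unfolded skew_in_def, rule_format,
      of "as @ y # x # bs" "length as" "Suc (length as)"]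
  by (simp add: nth_append list_update_append)

text \<open>Carrying \<open>x\<close> past \<open>cs\<close> one neighbour at a time costs one sign
  per entry of \<open>cs\<close>. Only adjacent exchanges are assumed, so the lemma is available
  before \<open>skew_in\<close> has been established.\<close>

lemma adjacent_skew_move:
  assumes skew: "\<And>as x y bs. length as + length bs + 2 = m \<Longrightarrow> a \<le> length as \<Longrightarrow> length as + 2 \<le> b
      \<Longrightarrow> f (as @ x # y # bs) = - f (as @ y # x # bs)"
    and "length as + length cs + length bs + 1 = m" "a \<le> length as" "length as + length cs + 1 \<le> b"
  shows "f (as @ x # cs @ bs) = signed (length cs) (f (as @ cs @ x # bs))"
  using assms(2-)
proof (induction cs arbitrary: as)
  case (Cons c cs)
  have "f (as @ x # c # (cs @ bs)) = - f (as @ c # x # (cs @ bs))"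
    using Cons.prems by (intro skew) auto
  also have "f (as @ c # x # (cs @ bs)) = signed (length cs) (f (as @ c # cs @ x # bs))"
    using Cons.IH[of "as @ [c]"] Cons.prems by simp
  finally show ?case by (simp add: signed_Suc)
qed simp

lemma skew_in_move:
  assumes "skew_in {a..<b} m f"
    and "length as + length cs + length bs + 1 = m" "a \<le> length as" "length as + length cs + 1 \<le> b"
  shows "f (as @ x # cs @ bs) = signed (length cs) (f (as @ cs @ x # bs))"
  by (rule adjacent_skew_move[where a = a and b = b and m = m])
    (use assms in \<open>auto intro!: skew_in_adjacentD[OF assms(1)]\<close>)

text \<open>Adjacent transpositions suffice: to exchange two entries separated by \<open>cs\<close>,
  move one past \<open>cs\<close>, swap the neighbours, and move the other back past
  \<open>cs\<close>. The two moves contribute the same sign, so the single swap leaves a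
  minus.\<close>

lemma skew_in_adjacentI:
  assumes skew: "\<And>as x y bs. length as + length bs + 2 = m \<Longrightarrow> a \<le> length as \<Longrightarrow> length as + 2 \<le> b
      \<Longrightarrow> f (as @ x # y # bs) = - f (as @ y # x # bs)"
    and "b \<le> m"
  shows "skew_in {a..<b} m f"
proof -
  have swap: "f (xs[i := xs ! j, j := xs ! i]) = - f xs"
    if "length xs = m" "a \<le> i" "i < j" "j < b" for xs i j
  proof -
    define as where "as = take i xs"
    define cs where "cs = take (j - Suc i) (drop (Suc i) xs)"
    define bs where "bs = drop (Suc j) xs"
    have len: "length as = i" "length cs = j - Suc i" "length bs = m - Suc j"
      using that \<open>b \<le> m\<close> by (auto simp: as_def cs_def bs_def)
    have "drop (Suc i) xs = cs @ xs ! j # bs"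
      unfolding cs_def bs_def
      using that \<open>b \<le> m\<close> by (subst id_take_nth_drop[of "j - Suc i"]) simp_all
    then have xs: "xs = as @ xs ! i # cs @ xs ! j # bs"
      unfolding as_def using that \<open>b \<le> m\<close> by (metis id_take_nth_drop less_le_trans less_trans)
    have j: "j = Suc (length as + length cs)"
      using len that by simp
    have upd: "xs[i := u, j := v] = as @ u # cs @ v # bs" for u v
      by (subst xs) (use len(1) in \<open>simp add: j list_update_append\<close>)
    have "f (as @ xs ! j # cs @ xs ! i # bs)
        = signed (length cs) (f (as @ cs @ xs ! j # xs ! i # bs))"
      using that len \<open>b \<le> m\<close>
      by (intro adjacent_skew_move[where f = f and m = m and a = a and b = b, OF skew]) auto
    also have "\<dots> = - signed (length cs) (f ((as @ cs) @ xs ! i # xs ! j # bs))"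
      using skew[of "as @ cs" bs "xs ! j" "xs ! i"] that len \<open>b \<le> m\<close> by (simp add: signed_minus)
    also have "f ((as @ cs) @ xs ! i # xs ! j # bs) = signed (length cs) (f (as @ xs ! i # cs @ xs ! j # bs))"
      using that len \<open>b \<le> m\<close>
        adjacent_skew_move[where f = f and m = m and a = a and b = b and as = as and cs = cs
          and bs = "xs ! j # bs" and x = "xs ! i", OF skew]
      by (simp add: signed_def)
    also have "as @ xs ! i # cs @ xs ! j # bs = xs"
      by (rule xs[symmetric])
    finally show ?thesis
      by (simp add: upd signed_def)
  qed
  have "f (xs[i := xs ! j, j := xs ! i]) = - f xs"
    if "length xs = m" "i \<in> {a..<b}" "j \<in> {a..<b}" "i \<noteq> j" for xs i j
    using swap[of xs i j] swap[of xs j i] that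
    by (cases "i < j") (auto simp: list_update_swap[of i j])
  then show ?thesis
    unfolding skew_in_def by blast
qed

text \<open>Alternating over the entry placed in front extends the skew-symmetry of \<open>F\<close>
  to position 0. When the neighbours at \<open>k\<close> and \<open>k + 1\<close> are swapped, the
  summands that put one of them in front change places and have opposite signs; every other summand
  changes sign because both neighbours lie in skew positions of \<open>F\<close>.\<close>

lemma skew_in_alternation:
  assumes F: "skew_in {1..<m} N F" and "m \<le> N"
  shows "skew_in {..<m} N (\<lambda>xs. \<Sum>i<m. signed i (F (xs ! i # omit i xs)))"
  unfolding lessThan_atLeast0
proof (rule skew_in_adjacentI)
  fix as bs :: "'a list" and x y
  assume len: "length as + length bs + 2 = N" and m: "length as + 2 \<le> m"
  let ?k = "length as"
  let ?T = "\<lambda>xs i. signed i (F (xs ! i # omit i xs))"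
  let ?xs = "as @ x # y # bs" and ?ys = "as @ y # x # bs"
  let ?\<pi> = "\<lambda>i. if i = ?k then Suc ?k else if i = Suc ?k then ?k else i"
  have oSuc: "omit (Suc ?k) (as @ u # v # bs) = as @ u # bs" for u v
    using omit_append_Suc[of as 0 u "v # bs"] by simp
  have main: "- ?T ?ys (?\<pi> i) = ?T ?xs i" if i: "i < m" for i
  proof -
    consider "i = ?k" | "i = Suc ?k" | "i < ?k" | "i > Suc ?k" by linarith
    then show ?thesis
    proof cases
      case 3
      then have "F (as ! i # omit i as @ x # y # bs) = - F (as ! i # omit i as @ y # x # bs)"
        using skew_in_adjacentD[OF F, of "as ! i # omit i as" bs x y] len m by simp
      with 3 show ?thesis by (simp add: nth_append signed_minus)
    next
      case 4
      define l where "l = i - Suc (Suc ?k)"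
      have l: "i = Suc (Suc (?k + l))" using 4 by (simp add: l_def)
      have o: "omit (Suc (Suc (?k + l))) (as @ u # v # bs) = as @ u # v # omit l bs" for u v
        using omit_append_Suc[of as "Suc l" u "v # bs"] by simp
      have "l < length bs" using i len \<open>m \<le> N\<close> l by simp
      \<comment> \<open>The entry taken from \<open>bs\<close> pushes \<open>x\<close> and
        \<open>y\<close> one place to the right, to positions \<open>?k + 1\<close> and
        \<open>?k + 2\<close>. The latter is at most \<open>i\<close>, hence still below
        \<open>m\<close>.\<close>
      then have "F (bs ! l # as @ x # y # omit l bs) = - F (bs ! l # as @ y # x # omit l bs)"
        using skew_in_adjacentD[OF F, of "bs ! l # as" "omit l bs" x y] len i l by simp
      then show ?thesis
        unfolding l by (simp add: o nth_append signed_minus)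
    qed (simp_all add: oSuc nth_append signed_Suc)
  qed
  have "(\<Sum>i\<in>{0..<m}. ?T ?xs i) = (\<Sum>i\<in>{0..<m}. - ?T ?ys i)"
    by (rule sum.reindex_bij_witness[where i = ?\<pi> and j = ?\<pi>]) (use m main in \<open>auto\<close>)
  then show "(\<Sum>i\<in>{0..<m}. ?T ?xs i) = - (\<Sum>i\<in>{0..<m}. ?T ?ys i)"
    by (simp add: sum_negf)
qed fact


subsection \<open>Multilinearity\<close>

lemma multilinear_linear:
  assumes "multilinear sA sB m f" and "length as + length bs + 1 = m"
  shows "Vector_Spaces.linear sA sB (\<lambda>a. f (as @ a # bs))"
  \<comment> \<open>\<open>undefined\<close> is a placeholder, overwritten by the update at position
    \<open>length as\<close>.\<close>
  using assms(2) assms(1)[unfolded multilinear_def, rule_format,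
      of "as @ undefined # bs" "length as"]
  by simp

text \<open>If \<open>p\<close> carries slot \<open>i\<close> to slot \<open>j\<close>, uniformly in
  the list, then linearity of the composite in slot \<open>i\<close> is linearity of
  \<open>f\<close> in slot \<open>j\<close>. This covers every rearrangement of arguments used
  below.\<close>

lemma multilinear_permuted:
  fixes f :: "'b::ab_group_add list \<Rightarrow> 'c::ab_group_add"
  assumes f: "multilinear sA sB m f"
    and len: "\<And>xs. length xs = m \<Longrightarrow> length (p xs) = m"
    and p: "\<And>i. i < m \<Longrightarrow> \<exists>j<m. \<forall>xs a. length xs = m \<longrightarrow> p (xs[i := a]) = (p xs)[j := a]"
  shows "multilinear sA sB m (\<lambda>xs. f (p xs))"
  unfolding multilinear_def
proof (intro allI impI)
  fix xs :: "'b list" and i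
  assume xs: "length xs = m" and "i < m"
  from p[OF \<open>i < m\<close>] obtain j
    where j: "j < m" and p': "\<forall>xs a. length xs = m \<longrightarrow> p (xs[i := a]) = (p xs)[j := a]"
    by (elim exE conjE)
  have eq: "p (xs[i := a]) = (p xs)[j := a]" for a
    by (rule p'[rule_format, OF xs])
  have "Vector_Spaces.linear sA sB (\<lambda>a. f ((p xs)[j := a]))"
    using f len[OF xs] j unfolding multilinear_def by blast
  then show "Vector_Spaces.linear sA sB (\<lambda>a. f (p (xs[i := a])))"
    unfolding eq .
qed

lemma multilinear_insert_front:
  fixes f :: "'b::ab_group_add list \<Rightarrow> 'c::ab_group_add"
  assumes "multilinear sA sB m f" and "i < m"
  shows "multilinear sA sB m (\<lambda>xs. f (xs ! i # omit i xs))"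
proof (rule multilinear_permuted[OF assms(1)])
  fix k assume "k < m"
  \<comment> \<open>The chosen entry moves to slot 0, earlier entries shift right by one, and later
    entries stay.\<close>
  define j where "j = (if k = i then 0 else if k < i then Suc k else k)"
  have "j < m" using \<open>k < m\<close> \<open>i < m\<close> by (auto simp: j_def)
  moreover have "xs[k := a] ! i # omit i (xs[k := a]) = (xs ! i # omit i xs)[j := a]"
    if "length xs = m" for xs :: "'b list" and a
  proof (cases "k = i")
    case False
    define l where "l = j - 1"
    have "k = (if l < i then l else Suc l)" "l < m - 1" "j = Suc l"
      using False \<open>k < m\<close> \<open>i < m\<close> by (auto simp: j_def l_def)
    then have "omit i (xs[k := a]) = (omit i xs)[l := a]"
      using omit_update[of i xs l a] \<open>i < m\<close> that by simp
    then show ?thesis using False \<open>j = Suc l\<close> by simp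
  qed (use that \<open>i < m\<close> in \<open>simp add: j_def omit_update_same\<close>)
  ultimately show "\<exists>j<m. \<forall>(xs :: 'b list) a. length xs = m \<longrightarrow>
      xs[k := a] ! i # omit i (xs[k := a]) = (xs ! i # omit i xs)[j := a]"
    by blast
qed (use assms(2) in simp)

lemma multilinear_rotate1:
  fixes f :: "'b::ab_group_add list \<Rightarrow> 'c::ab_group_add"
  assumes "multilinear sA sB m f"
  shows "multilinear sA sB m (\<lambda>xs. f (rotate1 xs))"
proof (rule multilinear_permuted[OF assms])
  fix i assume "i < m"
  then have "rotate1 (xs[i := a]) = (rotate1 xs)[(if i = 0 then m - 1 else i - 1) := a]"
    if "length xs = m" for xs :: "'b list" and a
    using that by (cases xs) (auto simp: list_update_append split: nat.splits)
  moreover have "(if i = 0 then m - 1 else i - 1) < m"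
    using \<open>i < m\<close> by auto
  ultimately show "\<exists>j<m. \<forall>(xs :: 'b list) a. length xs = m \<longrightarrow> rotate1 (xs[i := a]) = (rotate1 xs)[j := a]"
    by blast
qed simp

context vector_space
begin

lemma linear_signed_compose:
  assumes "Vector_Spaces.linear scale scale f"
  shows "Vector_Spaces.linear scale scale (\<lambda>x. signed k (f x))"
proof -
  interpret vector_space_pair scale scale by unfold_locales
  show ?thesis
    using assms linear_compose_neg[OF assms] by (cases "even k") (simp_all add: signed_def)
qed

lemma multilinear_signed:
  assumes "multilinear scale scale m f"
  shows "multilinear scale scale m (\<lambda>xs. signed k (f xs))"
  using assms by (simp add: multilinear_def linear_signed_compose)

lemma multilinear_add:
  assumes "multilinear scale scale m f" and "multilinear scale scale m g"
  shows "multilinear scale scale m (\<lambda>xs. f xs + g xs)"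
proof -
  interpret vector_space_pair scale scale by unfold_locales
  show ?thesis
    using assms by (simp add: multilinear_def linear_compose_add)
qed

lemma multilinear_sum:
  assumes "\<And>i. i \<in> A \<Longrightarrow> multilinear scale scale m (f i)"
  shows "multilinear scale scale m (\<lambda>xs. \<Sum>i\<in>A. f i xs)"
proof -
  interpret vector_space_pair scale scale by unfold_locales
  show ?thesis
    using assms by (simp add: multilinear_def linear_compose_sum)
qed

lemma multilinear_alternation:
  assumes "multilinear scale scale N F" and "m \<le> N"
  shows "multilinear scale scale N (\<lambda>xs. \<Sum>i<m. signed i (F (xs ! i # omit i xs)))"
  using assms by (auto intro!: multilinear_sum multilinear_signed multilinear_insert_front)

end

lemma skew_in_cong:
  assumes "skew_in I m f" and "\<And>xs. length xs = m \<Longrightarrow> g xs = f xs"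
  shows "skew_in I m g"
  using assms by (simp add: skew_in_def)

lemma skew_in_signed: "skew_in I m f \<Longrightarrow> skew_in I m (\<lambda>xs. signed k (f xs))"
  by (simp add: skew_in_def signed_minus)

lemma skew_in_add: "skew_in I m f \<Longrightarrow> skew_in I m g \<Longrightarrow> skew_in I m (\<lambda>xs. f xs + g xs)"
  by (simp add: skew_in_def)

lemma skew_in_rotate1:
  assumes "skew_in {..<m - 1} m f"
  shows "skew_in {1..<m} m (\<lambda>xs. f (rotate1 xs))"
proof (rule skew_in_adjacentI)
  fix as bs :: "'a list" and x y
  assume len: "length as + length bs + 2 = m" and "1 \<le> length as"
  then obtain z as' where as: "as = z # as'" by (cases as) auto
  show "f (rotate1 (as @ x # y # bs)) = - f (rotate1 (as @ y # x # bs))"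
    using skew_in_adjacentD[OF assms, of as' "bs @ [z]" x y] len by (simp add: as)
qed simp

lemma multilinear_cong:
  assumes "multilinear sA sB m f" and "\<And>xs. length xs = m \<Longrightarrow> g xs = f xs"
  shows "multilinear sA sB m g"
  using assms by (simp add: multilinear_def)


subsection \<open>n-pre-Lie and n-Lie algebras\<close>

context vector_space
begin

text \<open>Pulling out (-1)^(n-1) and rotating the arguments of \<open>br\<close> turns the
  commutator into an alternation over the front entry, so that
  \<open>multilinear_alternation\<close> and \<open>skew_in_alternation\<close> apply.\<close>

lemma sub_adjacent_eq_alternation:
  "sub_adjacent n scale br xs
    = signed (n - 1) (\<Sum>i<n. signed i (br (rotate1 (xs ! i # omit i xs))))"
  unfolding sub_adjacent_def scale_neg_one_power
  by (auto simp: signed_sum intro!: sum.cong signed_cong)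

lemma multilinear_sub_adjacent:
  assumes "multilinear scale scale n br"
  shows "multilinear scale scale n (sub_adjacent n scale br)"
  unfolding sub_adjacent_eq_alternation[abs_def]
  by (intro multilinear_signed multilinear_alternation multilinear_rotate1 assms order_refl)

lemma skew_in_sub_adjacent:
  assumes "skew_in {..<n - 1} n br"
  shows "skew_in {..<n} n (sub_adjacent n scale br)"
  unfolding sub_adjacent_eq_alternation[abs_def]
  by (intro skew_in_signed skew_in_alternation skew_in_rotate1 assms order_refl)

text \<open>The summand omitting \<open>c\<close> is \<open>br\<close> itself. In the others
  \<open>c\<close> moves to the front past \<open>n - 2\<close> skew arguments, and (-1)^(n-2)
  combines with the sign of the commutator to a sign independent of \<open>n\<close>.\<close>

lemma sub_adjacent_snoc:
  assumes "skew_in {..<n - 1} n br" and "length xs = n - 1" and "n \<ge> 1"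
  shows "sub_adjacent n scale br (xs @ [c])
    = br (xs @ [c]) + (\<Sum>j<n - 1. signed (Suc j) (br (c # omit j xs @ [xs ! j])))"
proof -
  have "sub_adjacent n scale br (xs @ [c])
      = br (xs @ [c]) + (\<Sum>j<n - 1. signed (n - Suc j) (br (omit j (xs @ [c]) @ [(xs @ [c]) ! j])))"
    unfolding sub_adjacent_def scale_neg_one_power
    using assms(2,3) omit_append_length[of xs c "[]"]
    by (cases n) (auto simp: nth_append)
  also have "(\<Sum>j<n - 1. signed (n - Suc j) (br (omit j (xs @ [c]) @ [(xs @ [c]) ! j])))
      = (\<Sum>j<n - 1. signed (Suc j) (br (c # omit j xs @ [xs ! j])))"
  proof (intro sum.cong refl)
    fix j assume j: "j \<in> {..<n - 1}"
    have "br (c # omit j xs @ [xs ! j]) = signed (n - 2) (br (omit j xs @ [c, xs ! j]))"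
      using skew_in_move[of 0 "n - 1" n br "[]" "omit j xs" "[xs ! j]" c] assms j
      by (simp add: lessThan_atLeast0 numeral_2_eq_2)
    then show "signed (n - Suc j) (br (omit j (xs @ [c]) @ [(xs @ [c]) ! j]))
        = signed (Suc j) (br (c # omit j xs @ [xs ! j]))"
      using j assms(2) by (auto simp: nth_append intro!: signed_cong)
  qed
  finally show ?thesis .
qed

text \<open>The first pre-Lie identity says how \<open>xs\<close> acts on each summand of the inner
  commutator; the second one rewrites the summands of the outer commutator in which the inner one is
  the first argument. Together they assemble the derivation rule.\<close>

lemma n_pre_lie_imp_n_lie:
  assumes "n_pre_lie n scale br" and "n \<ge> 1"
  shows "n_lie n scale (sub_adjacent n scale br)"
  unfolding n_lie_def
proof (intro conjI allI impI)
  let ?C = "sub_adjacent n scale br"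
  have ml: "multilinear scale scale n br" and skew: "skew_in {..<n - 1} n br"
    and deriv: "\<And>xs ys. length xs = n - 1 \<Longrightarrow> length ys = n \<Longrightarrow>
        br (xs @ [br ys]) = (\<Sum>i<n - 1. br (ys[i := ?C (xs @ [ys ! i])]))
          + br (butlast ys @ [br (xs @ [last ys])])"
    and comm: "\<And>xs ys. length xs = n \<Longrightarrow> length ys = n - 1 \<Longrightarrow>
        br (?C xs # ys) = (\<Sum>i<n. signed (n - Suc i) (br (omit i xs @ [br (xs ! i # ys)])))"
    using assms(1) unfolding n_pre_lie_def scale_neg_one_power by auto
  show "multilinear scale scale n ?C"
    by (rule multilinear_sub_adjacent[OF ml])
  show "skew_in {..<n} n ?C"
    by (rule skew_in_sub_adjacent[OF skew])
  fix xs ys :: "'b list"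
  assume xs: "length xs = n - 1" and ys: "length ys = n"
  have lin: "Vector_Spaces.linear scale scale (\<lambda>a. br (zs @ [a]))" if "length zs = n - 1" for zs
    using multilinear_linear[OF ml, of zs "[]"] that assms(2) by simp
  have C: "?C zs = (\<Sum>i<n. signed (n - Suc i) (br (omit i zs @ [zs ! i])))" for zs
    by (simp add: sub_adjacent_def scale_neg_one_power)
  let ?c = "\<lambda>u. ?C (xs @ [u])"
  \<comment> \<open>In \<open>?D\<close> the list \<open>xs\<close> acts through the commutator on
    an argument before the last, in \<open>?E\<close> through \<open>br\<close> on the last one.
    \<open>?F\<close> collects the outer summands that have the inner commutator in front.\<close>
  let ?D = "\<Sum>j<n. \<Sum>i<n - 1. signed (n - Suc j) (br ((omit j ys)[i := ?c (omit j ys ! i)] @ [ys ! j]))"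
  let ?E = "\<Sum>j<n. signed (n - Suc j) (br (omit j ys @ [br (xs @ [ys ! j])]))"
  let ?F = "\<Sum>i<n. \<Sum>j<n - 1. signed (n - Suc i + Suc j) (br (omit i ys @ [br (ys ! i # omit j xs @ [xs ! j])]))"
  have "br (xs @ [?C ys]) = (\<Sum>j<n. signed (n - Suc j) (br (xs @ [br (omit j ys @ [ys ! j])])))"
    unfolding C[of ys] by (rule linear_signed_sum[OF lin[OF xs]])
  also have "\<dots> = (\<Sum>j<n. signed (n - Suc j)
      ((\<Sum>i<n - 1. br ((omit j ys)[i := ?c (omit j ys ! i)] @ [ys ! j]))
        + br (omit j ys @ [br (xs @ [ys ! j])])))"
  proof (intro sum.cong refl arg_cong[where f = "signed _"])
    fix j assume "j \<in> {..<n}"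
    then show "br (xs @ [br (omit j ys @ [ys ! j])])
      = (\<Sum>i<n - 1. br ((omit j ys)[i := ?c (omit j ys ! i)] @ [ys ! j]))
        + br (omit j ys @ [br (xs @ [ys ! j])])"
      using deriv[of xs "omit j ys @ [ys ! j]"] xs ys
      by (simp add: list_update_append nth_append)
  qed
  also have "\<dots> = ?D + ?E"
    by (simp add: signed_plus signed_sum sum.distrib)
  finally have 1: "br (xs @ [?C ys]) = ?D + ?E" .
  have "(\<Sum>j<n - 1. signed (Suc j) (br (?C ys # omit j xs @ [xs ! j]))) = ?F"
    using xs ys by (subst sum.swap) (simp add: comm signed_sum add.commute)
  then have "?C (xs @ [?C ys]) = ?D + (?E + ?F)"
    using 1 sub_adjacent_snoc[OF skew xs assms(2), of "?C ys"] by (simp only: add.assoc)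
  \<comment> \<open>By \<open>sub_adjacent_snoc\<close>, \<open>?E\<close> and \<open>?F\<close> are
    the two parts of a commutator in the last argument.\<close>
  also have "?E + ?F = (\<Sum>i<n. signed (n - Suc i) (br (omit i ys @ [?c (ys ! i)])))"
  proof -
    have "br (omit i ys @ [?c (ys ! i)]) = br (omit i ys @ [br (xs @ [ys ! i])])
      + (\<Sum>j<n - 1. signed (Suc j) (br (omit i ys @ [br (ys ! i # omit j xs @ [xs ! j])])))"
      if "i < n" for i
    proof -
      have l: "Vector_Spaces.linear scale scale (\<lambda>a. br (omit i ys @ [a]))"
        using that ys by (intro lin) simp
      interpret Vector_Spaces.linear scale scale "\<lambda>a. br (omit i ys @ [a])" by (rule l)
      show ?thesis
        by (simp only: sub_adjacent_snoc[OF skew xs assms(2)] add linear_signed_sum[OF l])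
    qed
    then show ?thesis
      by (simp add: signed_plus signed_sum sum.distrib)
  qed
  \<comment> \<open>The Leibniz rule \<open>sum_update_omit\<close>: the replaced entry is the one
    moved to the end, or one of the remaining ones as in \<open>?D\<close>.\<close>
  also have "?D + \<dots> = (\<Sum>i<n. ?C (ys[i := ?c (ys ! i)]))"
    unfolding C[of "ys[_ := _]"]
    using sum_update_omit[of n ys "\<lambda>j u zs. signed (n - Suc j) (br (zs @ [u]))" ?c] ys
    by (simp add: add.commute)
  finally show "?C (xs @ [?C ys]) = (\<Sum>i<n. ?C (ys[i := ?c (ys ! i)]))" .
qed

lemma skew_operator_map_left_mult:
  assumes "multilinear scale scale n f" and "skew_in {..<n - 1} n f" and "n \<ge> 1"
  shows "skew_operator_map scale scale {..<n - 1} (n - 1) (left_mult f)"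
  unfolding skew_operator_map_def left_mult_def
proof (intro conjI allI impI)
  show "Vector_Spaces.linear scale scale (\<lambda>v. f (xs @ [v]))" if "length xs = n - 1" for xs
    using multilinear_linear[OF assms(1), of xs "[]"] that assms(3) by simp
  show "multilinear scale scale (n - 1) (\<lambda>xs. f (xs @ [v]))" for v
    unfolding multilinear_def
  proof (intro allI impI)
    fix xs :: "'b list" and i
    assume "length xs = n - 1" "i < n - 1"
    then show "Vector_Spaces.linear scale scale (\<lambda>a. f (xs[i := a] @ [v]))"
      using assms(1)[unfolded multilinear_def, rule_format, of "xs @ [v]" i] assms(3)
      by (simp add: list_update_append)
  qed
  show "skew_in {..<n - 1} (n - 1) (\<lambda>xs. f (xs @ [v]))" for v
    unfolding skew_in_def
  proof (intro allI impI ballI)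
    fix xs :: "'b list" and i j
    assume "length xs = n - 1" "i \<in> {..<n - 1}" "j \<in> {..<n - 1}" "i \<noteq> j"
    then show "f (xs[i := xs ! j, j := xs ! i] @ [v]) = - f (xs @ [v])"
      using assms(2)[unfolded skew_in_def, rule_format, of "xs @ [v]" i j] assms(3)
      by (simp add: list_update_append nth_append)
  qed
qed

text \<open>With \<open>v\<close> as last argument, the second pre-Lie identity becomes the
  condition on a bracket argument, and the first one becomes the commutator condition.\<close>

lemma n_pre_lie_left_mult_rep:
  assumes br: "n_pre_lie n scale br" and n: "n \<ge> 2"
  shows "n_lie_rep n scale (sub_adjacent n scale br) scale (left_mult br)"
  unfolding n_lie_rep_def
proof (intro conjI allI impI)
  let ?C = "sub_adjacent n scale br"
  have ml: "multilinear scale scale n br" and skew: "skew_in {..<n - 1} n br"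
    and deriv: "\<And>xs ys. length xs = n - 1 \<Longrightarrow> length ys = n \<Longrightarrow>
        br (xs @ [br ys]) = (\<Sum>i<n - 1. br (ys[i := ?C (xs @ [ys ! i])]))
          + br (butlast ys @ [br (xs @ [last ys])])"
    and comm: "\<And>xs ys. length xs = n \<Longrightarrow> length ys = n - 1 \<Longrightarrow>
        br (?C xs # ys) = (\<Sum>i<n. (-1) ^ (n - Suc i) *s br (omit i xs @ [br (xs ! i # ys)]))"
    using br unfolding n_pre_lie_def by auto
  show "n_lie n scale (sub_adjacent n scale br)"
    using n_pre_lie_imp_n_lie[OF br] n by simp
  show "skew_operator_map scale scale {..<n - 1} (n - 1) (left_mult br)"
    using skew_operator_map_left_mult[OF ml skew] n by simp
  fix xs ys :: "'b list" and v
  show "left_mult br (sub_adjacent n scale br xs # ys) v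
      = (\<Sum>i<n. (-1) ^ (n - Suc i) *s left_mult br (omit i xs) (left_mult br (xs ! i # ys) v))"
    if "length xs = n" "length ys = n - 2"
    using comm[of xs "ys @ [v]"] that n by (simp add: left_mult_def)
  show "left_mult br xs (left_mult br ys v) - left_mult br ys (left_mult br xs v)
      = (\<Sum>i<n - 1. left_mult br (ys[i := sub_adjacent n scale br (xs @ [ys ! i])]) v)"
    if "length xs = n - 1" "length ys = n - 1"
    using deriv[of xs "ys @ [v]"] that n by (simp add: left_mult_def list_update_append nth_append)
qed

end

section \<open>Independence of the values on lists of other lengths\<close>

lemma skew_operator_map_cong:
  assumes "skew_operator_map sA sV I m f" and "\<And>xs v. length xs = m \<Longrightarrow> g xs v = f xs v"
  shows "skew_operator_map sA sV I m g"
  unfolding skew_operator_map_def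
proof (intro conjI allI impI)
  show "Vector_Spaces.linear sV sV (g xs)" if "length xs = m" for xs
    using assms(1) assms(2)[OF that, abs_def] that by (simp add: skew_operator_map_def)
  show "multilinear sA sV m (\<lambda>xs. g xs v)" for v
    by (rule multilinear_cong[where f = "\<lambda>xs. f xs v"])
      (use assms in \<open>auto simp: skew_operator_map_def\<close>)
  show "skew_in I m (\<lambda>xs. g xs v)" for v
    by (rule skew_in_cong[where f = "\<lambda>xs. f xs v"])
      (use assms in \<open>auto simp: skew_operator_map_def\<close>)
qed

text \<open>Operations are total on lists but meaningful at one length only. This lemma allows
  exchanging the sub-adjacent bracket of the vertical bracket with that of the horizontal one, which
  are compared at length \<open>n\<close>.\<close>

lemma n_lie_rep_cong:
  assumes "n_lie_rep n sA br sV \<rho>" and n: "n \<ge> 2"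
    and br: "\<And>xs. length xs = n \<Longrightarrow> br' xs = br xs"
    and \<rho>: "\<And>xs v. length xs = n - 1 \<Longrightarrow> \<rho>' xs v = \<rho> xs v"
  shows "n_lie_rep n sA br' sV \<rho>'"
  unfolding n_lie_rep_def
proof (intro conjI allI impI)
  have lie: "n_lie n sA br" and skew: "skew_operator_map sA sV {..<n - 1} (n - 1) \<rho>"
    and bracket: "\<And>xs ys v. length xs = n \<Longrightarrow> length ys = n - 2 \<Longrightarrow> \<rho> (br xs # ys) v =
      (\<Sum>i<n. sV ((-1) ^ (n - Suc i)) (\<rho> (omit i xs) (\<rho> (xs ! i # ys) v)))"
    and comm: "\<And>xs ys v. length xs = n - 1 \<Longrightarrow> length ys = n - 1 \<Longrightarrow>
      \<rho> xs (\<rho> ys v) - \<rho> ys (\<rho> xs v) = (\<Sum>i<n - 1. \<rho> (ys[i := br (xs @ [ys ! i])]) v)"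
    using assms(1) unfolding n_lie_rep_def by auto
  show "n_lie n sA br'"
    unfolding n_lie_def
  proof (intro conjI allI impI)
    show "multilinear sA sA n br'" "skew_in {..<n} n br'"
      using lie multilinear_cong[of sA sA n br br'] skew_in_cong[of "{..<n}" n br br'] br
      by (auto simp: n_lie_def)
    show "br' (xs @ [br' ys]) = (\<Sum>i<n. br' (ys[i := br' (xs @ [ys ! i])]))"
      if "length xs = n - 1" "length ys = n" for xs ys
      using lie that n unfolding n_lie_def by (simp add: br)
  qed
  show "skew_operator_map sA sV {..<n - 1} (n - 1) \<rho>'"
    by (rule skew_operator_map_cong[OF skew \<rho>])
  show "\<rho>' (br' xs # ys) v = (\<Sum>i<n. sV ((-1) ^ (n - Suc i)) (\<rho>' (omit i xs) (\<rho>' (xs ! i # ys) v)))"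
    if "length xs = n" "length ys = n - 2" for xs ys v
    using bracket[OF that] that n by (simp add: br \<rho>)
  show "\<rho>' xs (\<rho>' ys v) - \<rho>' ys (\<rho>' xs v) = (\<Sum>i<n - 1. \<rho>' (ys[i := br' (xs @ [ys ! i])]) v)"
    if "length xs = n - 1" "length ys = n - 1" for xs ys v
    using comm[OF that] that n by (simp add: br \<rho>)
qed


subsection \<open>n-L-dendriform algebras\<close>

locale L_dendriform_space = vector_space scale
  for scale :: "'k::field \<Rightarrow> 'b::ab_group_add \<Rightarrow> 'b" (infixr "*s" 75) +
  fixes n :: nat and NW NE :: "'b list \<Rightarrow> 'b"
  assumes n: "n \<ge> 2"
    and dendriform: "n_L_dendriform n scale NW NE"
begin

abbreviation "hor \<equiv> horizontal n scale NW NE"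
abbreviation "vert \<equiv> vertical n scale NW NE"
abbreviation "comm \<equiv> dend_comm n scale NW NE"

section \<open>Linearity in single arguments and expansions of the two brackets\<close>

lemma multilinear_NW: "multilinear scale scale n NW"
  and skew_NW: "skew_in {..<n - 1} n NW"
  and multilinear_NE: "multilinear scale scale n NE"
  and skew_NE: "skew_in {1..<n - 1} n NE"
  using dendriform unfolding n_L_dendriform_def by auto

lemma linear_NW_last: "length xs = n - 1 \<Longrightarrow> Vector_Spaces.linear scale scale (\<lambda>a. NW (xs @ [a]))"
  using multilinear_linear[OF multilinear_NW, of xs "[]"] n by simp

lemma linear_NE_last:
  "length xs = n - 2 \<Longrightarrow> Vector_Spaces.linear scale scale (\<lambda>a. NE (z # xs @ [a]))"
  using multilinear_linear[OF multilinear_NE, of "z # xs" "[]"] n by simp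

lemma linear_NE_first: "length xs = n - 1 \<Longrightarrow> Vector_Spaces.linear scale scale (\<lambda>a. NE (a # xs))"
  using multilinear_linear[OF multilinear_NE, of "[]" xs] n by simp

lemma hor_snoc:
  "length ys = n - 1 \<Longrightarrow>
    hor (ys @ [w]) = NW (ys @ [w]) + (\<Sum>i<n - 1. signed i (NE (ys ! i # omit i ys @ [w])))"
  by (simp add: horizontal_def scale_neg_one_power nth_append)

lemma vert_snoc:
  "length ys = n - 1 \<Longrightarrow>
    vert (ys @ [w]) = NW (ys @ [w]) + (\<Sum>i<n - 1. signed (Suc i) (NE (w # omit i ys @ [ys ! i])))"
  by (simp add: vertical_def scale_neg_one_power nth_append del: power_Suc)

text \<open>Splitting off the summand of index 0 sorts the terms by the slot of \<open>c\<close>: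
  the first slot of \<open>NW\<close>, the first of \<open>NE\<close>, or the one after the first of
  \<open>NE\<close>. In \<open>vert_Cons\<close> the last slot of \<open>NE\<close> replaces its
  first one. The second pre-Lie identity needs this with a commutator as \<open>c\<close>.\<close>

lemma hor_Cons:
  assumes "length us = n - 2"
  shows "hor (c # us @ [w]) = NW (c # us @ [w]) + NE (c # us @ [w])
    + (\<Sum>j<n - 2. signed (Suc j) (NE (us ! j # c # omit j us @ [w])))"
proof -
  define m where "m = n - 2"
  have "n = Suc (Suc m)" using n by (simp add: m_def)
  then show ?thesis
    using hor_snoc[of "c # us" w] assms by (simp add: sum.lessThan_Suc_shift add.assoc del: sum.lessThan_Suc)
qed

lemma vert_Cons:
  assumes "length us = n - 2"
  shows "vert (c # us @ [w]) = NW (c # us @ [w]) - NE (w # us @ [c])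
    + (\<Sum>j<n - 2. signed j (NE (w # c # omit j us @ [us ! j])))"
proof -
  define m where "m = n - 2"
  have "n = Suc (Suc m)" using n by (simp add: m_def)
  then show ?thesis
    using vert_snoc[of "c # us" w] assms
    by (simp add: sum.lessThan_Suc_shift signed_Suc sum_negf del: sum.lessThan_Suc)
qed

section \<open>Multilinearity and skew-symmetry of the two brackets\<close>

lemma multilinear_hor: "multilinear scale scale n hor"
  unfolding horizontal_def[abs_def] scale_neg_one_power
  by (intro multilinear_add multilinear_alternation multilinear_NW multilinear_NE) simp

lemma skew_hor: "skew_in {..<n - 1} n hor"
  unfolding horizontal_def[abs_def] scale_neg_one_power
  by (intro skew_in_add skew_in_alternation skew_NW skew_NE) simp

text \<open>The inner function exchanges the first and last entries of a list with at least two
  entries. Composing \<open>NE\<close> with it makes the vertical bracket an alternation over the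
  front entry.\<close>

lemma vert_eq_alternation:
  assumes "length xs = n"
  shows "vert xs = NW xs + signed 1 (\<Sum>i<n - 1. signed i
    ((\<lambda>zs. NE (last zs # butlast (tl zs) @ [hd zs])) (xs ! i # omit i xs)))"
proof -
  have "NE (last xs # omit i (butlast xs) @ [xs ! i])
      = (\<lambda>zs. NE (last zs # butlast (tl zs) @ [hd zs])) (xs ! i # omit i xs)" if "i < n - 1" for i
  proof -
    have "length (omit i xs) \<noteq> 0"
      using that assms by simp
    then have "omit i xs \<noteq> []"
      by (simp only: length_0_conv not_False_eq_True)
    then show ?thesis
      using last_omit[of i xs] omit_butlast[of i xs] that assms by simp
  qed
  then have "(\<Sum>i<n - 1. signed i (NE (last xs # omit i (butlast xs) @ [xs ! i])))
      = (\<Sum>i<n - 1. signed i ((\<lambda>zs. NE (last zs # butlast (tl zs) @ [hd zs])) (xs ! i # omit i xs)))"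
    by (intro sum.cong refl) simp
  then show ?thesis
    unfolding vertical_def scale_neg_one_power signed_sum by (simp add: signed_Suc sum_negf)
qed

lemma multilinear_vert: "multilinear scale scale n vert"
proof (rule multilinear_cong[OF _ vert_eq_alternation])
  have "multilinear scale scale n (\<lambda>zs. NE (last zs # butlast (tl zs) @ [hd zs]))"
  proof (rule multilinear_permuted[OF multilinear_NE])
    fix i assume "i < n"
    define j where "j = (if i = 0 then n - 1 else if i = n - 1 then 0 else i)"
    have "last (xs[i := a]) # butlast (tl (xs[i := a])) @ [hd (xs[i := a])]
      = (last xs # butlast (tl xs) @ [hd xs])[j := a]" if len: "length xs = n" for xs :: "'b list" and a
    proof -
      obtain x ys where "xs = x # ys" using len n by (cases xs) auto
      moreover obtain zs w where "ys = zs @ [w]"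
        using \<open>xs = x # ys\<close> len n by (cases ys rule: rev_cases) auto
      ultimately have xs: "xs = x # zs @ [w]" by simp
      consider "i = 0" | "i = n - 1" "i \<noteq> 0" | k where "i = Suc k" "k < length zs"
        using \<open>i < n\<close> len xs by (cases i) (simp, force)
      then show ?thesis
        by cases (use len n in \<open>auto simp: xs j_def list_update_append\<close>)
    qed
    moreover have "j < n" using \<open>i < n\<close> by (auto simp: j_def)
    ultimately show "\<exists>j<n. \<forall>(xs :: 'b list) a. length xs = n \<longrightarrow>
        last (xs[i := a]) # butlast (tl (xs[i := a])) @ [hd (xs[i := a])]
          = (last xs # butlast (tl xs) @ [hd xs])[j := a]"
      by blast
  qed (use n in simp)
  then show "multilinear scale scale n (\<lambda>xs. NW xs + signed 1 (\<Sum>i<n - 1. signed i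
    ((\<lambda>zs. NE (last zs # butlast (tl zs) @ [hd zs])) (xs ! i # omit i xs))))"
    by (intro multilinear_add multilinear_signed multilinear_alternation multilinear_NW) simp_all
qed

lemma skew_vert: "skew_in {..<n - 1} n vert"
proof (rule skew_in_cong[OF _ vert_eq_alternation])
  \<comment> \<open>Exchanging the end entries leaves the positions from 1 to \<open>n - 2\<close>
    in place, and these are the skew positions of \<open>NE\<close>.\<close>
  have "skew_in {1..<n - 1} n (\<lambda>zs. NE (last zs # butlast (tl zs) @ [hd zs]))"
  proof (rule skew_in_adjacentI)
    fix as bs :: "'b list" and x y
    assume len: "length as + length bs + 2 = n" and a: "1 \<le> length as" and "length as + 2 \<le> n - 1"
    obtain a as' where as: "as = a # as'" using a by (cases as) auto
    obtain bs' b where bs: "bs = bs' @ [b]"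
      using len \<open>length as + 2 \<le> n - 1\<close> n by (cases bs rule: rev_cases) auto
    show "NE (last (as @ x # y # bs) # butlast (tl (as @ x # y # bs)) @ [hd (as @ x # y # bs)])
      = - NE (last (as @ y # x # bs) # butlast (tl (as @ y # x # bs)) @ [hd (as @ y # x # bs)])"
      using skew_in_adjacentD[OF skew_NE, of "b # as'" "bs' @ [a]" x y] len
      by (simp add: as bs butlast_append)
  qed simp
  then show "skew_in {..<n - 1} n (\<lambda>xs. NW xs + signed 1 (\<Sum>i<n - 1. signed i
    ((\<lambda>zs. NE (last zs # butlast (tl zs) @ [hd zs])) (xs ! i # omit i xs))))"
    by (intro skew_in_add skew_in_signed skew_in_alternation skew_NW) simp_all
qed

section \<open>The common sub-adjacent bracket\<close>

lemma comm_eq_hor: "comm xs = (\<Sum>i<n. signed (n - Suc i) (hor (omit i xs @ [xs ! i])))"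
  by (simp add: dend_comm_def sub_adjacent_def scale_neg_one_power)

text \<open>The \<open>NW\<close> parts coincide. The \<open>NE\<close> parts are double sums over
  two removed entries, placed first and last; exchanging their roles changes the sign and turns the
  horizontal terms into the vertical ones.\<close>

lemma comm_eq_vert:
  assumes xs: "length xs = n"
  shows "comm xs = (\<Sum>i<n. signed (n - Suc i) (vert (omit i xs @ [xs ! i])))"
proof -
  have "comm xs = (\<Sum>i<n. signed (n - Suc i) (NW (omit i xs @ [xs ! i])))
    + (\<Sum>i<n. \<Sum>k<n - 1. signed (n - Suc i + k)
        (NE (omit i xs ! k # omit k (omit i xs) @ [xs ! i])))"
    using xs by (simp add: comm_eq_hor hor_snoc signed_plus signed_sum sum.distrib)
  also have "\<dots> = (\<Sum>i<n. signed (n - Suc i) (NW (omit i xs @ [xs ! i])))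
    + (\<Sum>i<n. \<Sum>k<n - 1. signed (n - Suc i + Suc k)
        (NE (xs ! i # omit k (omit i xs) @ [omit i xs ! k])))"
    using sum_omit_omit_swap_signed[OF xs, of "\<lambda>a b r. NE (a # r @ [b])"] by simp
  also have "\<dots> = (\<Sum>i<n. signed (n - Suc i) (vert (omit i xs @ [xs ! i])))"
    using xs by (simp add: vert_snoc signed_plus signed_sum sum.distrib)
  finally show ?thesis .
qed

lemma sub_adjacent_vert: "length xs = n \<Longrightarrow> sub_adjacent n scale vert xs = comm xs"
  by (simp add: comm_eq_vert sub_adjacent_def scale_neg_one_power)

lemma comm_snoc_hor:
  "length xs = n - 1 \<Longrightarrow> comm (xs @ [c])
    = hor (xs @ [c]) + (\<Sum>j<n - 1. signed (Suc j) (hor (c # omit j xs @ [xs ! j])))"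
  unfolding dend_comm_def using sub_adjacent_snoc[OF skew_hor] n by simp

lemma comm_snoc_vert:
  "length xs = n - 1 \<Longrightarrow> comm (xs @ [c])
    = vert (xs @ [c]) + (\<Sum>j<n - 1. signed (Suc j) (vert (c # omit j xs @ [xs ! j])))"
  using sub_adjacent_snoc[OF skew_vert] sub_adjacent_vert[of "xs @ [c]"] n by simp

section \<open>The axioms with the last argument separated\<close>

lemma NW_NW:
  assumes "length xs = n - 1" and "length ys = n - 1"
  shows "NW (xs @ [NW (ys @ [w])]) = NW (ys @ [NW (xs @ [w])])
    + (\<Sum>i<n - 1. NW (ys[i := comm (xs @ [ys ! i])] @ [w]))"
proof -
  have "\<forall>xs ys. length xs = n - 1 \<longrightarrow> length ys = n \<longrightarrow>
        NW (xs @ [NW ys]) - NW (butlast ys @ [NW (xs @ [last ys])]) =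
          (\<Sum>i<n - 1. NW (ys[i := comm (xs @ [ys ! i])]))"
    using dendriform unfolding n_L_dendriform_def by blast
  from this[rule_format, of xs "ys @ [w]"] show ?thesis
    using assms n by (simp add: list_update_append nth_append algebra_simps)
qed

lemma NW_comm:
  assumes "length xs = n" and "length ys = n - 1"
  shows "NW (comm xs # ys) = (\<Sum>i<n. signed (n - Suc i) (NW (omit i xs @ [NW (xs ! i # ys)])))"
  using dendriform assms unfolding n_L_dendriform_def scale_neg_one_power by blast

lemma NW_NE:
  assumes "length xs = n - 1" and "length ys = n - 2"
  shows "NW (xs @ [NE (z # ys @ [w])]) = NE (z # ys @ [hor (xs @ [w])])
    + NE (vert (xs @ [z]) # ys @ [w]) + (\<Sum>i<n - 2. NE (z # ys[i := comm (xs @ [ys ! i])] @ [w]))"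
proof -
  have "\<forall>xs ys z. length xs = n - 1 \<longrightarrow> length ys = n - 1 \<longrightarrow>
        NW (xs @ [NE (z # ys)]) - NE (z # butlast ys @ [hor (xs @ [last ys])]) =
          NE (vert (xs @ [z]) # ys) + (\<Sum>i<n - 2. NE (z # ys[i := comm (xs @ [ys ! i])]))"
    using dendriform unfolding n_L_dendriform_def by blast
  from this[rule_format, of xs "ys @ [w]" z] show ?thesis
    using assms n by (simp add: list_update_append nth_append algebra_simps)
qed

lemma NE_comm:
  assumes "n \<ge> 3" and "length xs = n" and "length ys = n - 2"
  shows "NE (z # comm xs # ys) = (\<Sum>i<n. signed (n - Suc i) (NW (omit i xs @ [NE (z # xs ! i # ys)])))"
  using dendriform assms unfolding n_L_dendriform_def scale_neg_one_power by blast

text \<open>Moving \<open>ys ! i\<close> to the front of the vertical bracket passes the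
  \<open>n - 2\<close> entries of \<open>xs\<close> and cancels the factor (-1)^n in the axiom. The
  result matches the summands of \<open>sub_adjacent_snoc\<close>.\<close>

lemma NE_hor:
  assumes "length xs = n - 2" and "length ys = n - 1"
  shows "NE (z # xs @ [hor (ys @ [w])]) = NW (ys @ [NE (z # xs @ [w])])
    + (\<Sum>i<n - 1. signed (Suc i) (NE (vert (ys ! i # xs @ [z]) # omit i ys @ [w])))"
proof -
  have "\<forall>xs ys z. length xs = n - 2 \<longrightarrow> length ys = n \<longrightarrow>
        NE (z # xs @ [hor ys]) - NW (butlast ys @ [NE (z # xs @ [last ys])]) =
          (\<Sum>i<n - 1. signed (n + Suc i) (NE (vert (xs @ [ys ! i, z]) # omit i ys)))"
    using dendriform unfolding n_L_dendriform_def scale_neg_one_power by blast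
  from this[rule_format, of xs "ys @ [w]" z]
  have "NE (z # xs @ [hor (ys @ [w])]) = NW (ys @ [NE (z # xs @ [w])])
    + (\<Sum>i<n - 1. signed (n + Suc i) (NE (vert (xs @ [ys ! i, z]) # omit i ys @ [w])))"
    using assms n by (simp add: nth_append algebra_simps)
  also have "(\<Sum>i<n - 1. signed (n + Suc i) (NE (vert (xs @ [ys ! i, z]) # omit i ys @ [w])))
    = (\<Sum>i<n - 1. signed (Suc i) (NE (vert (ys ! i # xs @ [z]) # omit i ys @ [w])))"
  proof (intro sum.cong refl)
    fix i assume i: "i \<in> {..<n - 1}"
    have "vert (ys ! i # xs @ [z]) = signed n (vert (xs @ [ys ! i, z]))"
      using skew_in_move[of 0 "n - 1" n vert "[]" xs "[z]" "ys ! i"] skew_vert assms n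
      by (auto simp: lessThan_atLeast0 intro!: signed_cong)
    moreover have "NE (signed n u # omit i ys @ [w]) = signed n (NE (u # omit i ys @ [w]))" for u
      using linear_signed[OF linear_NE_first, of "omit i ys @ [w]"] assms n i by simp
    ultimately show "signed (n + Suc i) (NE (vert (xs @ [ys ! i, z]) # omit i ys @ [w]))
      = signed (Suc i) (NE (vert (ys ! i # xs @ [z]) # omit i ys @ [w]))"
      by (simp add: add.commute)
  qed
  finally show ?thesis .
qed

lemma NE_vert:
  assumes "length xs = n - 1" and "length ys = n - 2"
  shows "NE (vert (xs @ [z]) # ys @ [w]) = NW (xs @ [NE (z # ys @ [w])])
    + (\<Sum>i<n - 1. signed (Suc i) (NE (z # omit i xs @ [hor (xs ! i # ys @ [w])])))"
proof -
  have "\<forall>xs ys z. length xs = n - 1 \<longrightarrow> length ys = n - 1 \<longrightarrow>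
        NE (vert (xs @ [z]) # ys) - NW (xs @ [NE (z # ys)]) =
          (\<Sum>i<n - 1. signed (Suc i) (NE (z # omit i xs @ [hor (xs ! i # ys)])))"
    using dendriform unfolding n_L_dendriform_def scale_neg_one_power by blast
  from this[rule_format, of xs "ys @ [w]" z] show ?thesis
    using assms n by (simp add: algebra_simps)
qed

section \<open>Nested operations expanded by linearity\<close>

lemma NW_hor:
  assumes "length xs = n - 1" and "length ys = n - 1"
  shows "NW (xs @ [hor (ys @ [w])]) = NW (xs @ [NW (ys @ [w])])
    + (\<Sum>i<n - 1. signed i (NW (xs @ [NE (ys ! i # omit i ys @ [w])])))"
proof -
  interpret l: Vector_Spaces.linear scale scale "\<lambda>a. NW (xs @ [a])" by (rule linear_NW_last) fact
  show ?thesis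
    unfolding hor_snoc[OF assms(2)] l.add linear_signed_sum[OF linear_NW_last[OF assms(1)]] ..
qed

lemma NW_vert:
  assumes "length xs = n - 1" and "length ys = n - 1"
  shows "NW (xs @ [vert (ys @ [w])]) = NW (xs @ [NW (ys @ [w])])
    + (\<Sum>i<n - 1. signed (Suc i) (NW (xs @ [NE (w # omit i ys @ [ys ! i])])))"
proof -
  interpret l: Vector_Spaces.linear scale scale "\<lambda>a. NW (xs @ [a])" by (rule linear_NW_last) fact
  show ?thesis
    unfolding vert_snoc[OF assms(2)] l.add linear_signed_sum[OF linear_NW_last[OF assms(1)]] ..
qed

text \<open>In the last slot of \<open>NE\<close> the commutator is expanded in the horizontal
  bracket, and in the first slot (\<open>NE_comm_snoc_first\<close>) in the vertical one, since
  these are the brackets that the axioms have in those slots.\<close>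

lemma NE_comm_snoc_last:
  assumes "length xs = n - 1" and "length ys = n - 2"
  shows "NE (z # ys @ [comm (xs @ [u])]) = NE (z # ys @ [hor (xs @ [u])])
    + (\<Sum>j<n - 1. signed (Suc j) (NE (z # ys @ [hor (u # omit j xs @ [xs ! j])])))"
proof -
  interpret l: Vector_Spaces.linear scale scale "\<lambda>a. NE (z # ys @ [a])" by (rule linear_NE_last) fact
  show ?thesis
    unfolding comm_snoc_hor[OF assms(1)] l.add linear_signed_sum[OF linear_NE_last[OF assms(2)]] ..
qed

lemma NE_comm_snoc_first:
  assumes "length xs = n - 1" and "length ys = n - 1"
  shows "NE (comm (xs @ [u]) # ys) = NE (vert (xs @ [u]) # ys)
    + (\<Sum>j<n - 1. signed (Suc j) (NE (vert (u # omit j xs @ [xs ! j]) # ys)))"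
proof -
  interpret l: Vector_Spaces.linear scale scale "\<lambda>a. NE (a # ys)" by (rule linear_NE_first) fact
  show ?thesis
    unfolding comm_snoc_vert[OF assms(1)] l.add linear_signed_sum[OF linear_NE_first[OF assms(2)]] ..
qed

section \<open>The two pre-Lie identities for each bracket\<close>

lemma hor_hor:
  assumes xs: "length xs = n - 1" and us: "length us = n - 1"
  shows "hor (xs @ [hor (us @ [w])])
    = (\<Sum>i<n - 1. hor (us[i := comm (xs @ [us ! i])] @ [w])) + hor (us @ [hor (xs @ [w])])"
proof -
  let ?c = "\<lambda>u. comm (xs @ [u])"
  \<comment> \<open>\<open>P\<close>, \<open>Q\<close>, \<open>R\<close> arise from
    \<open>NW_NE\<close>, with \<open>xs\<close> acting on the last, the first or a middle argument
    of \<open>NE\<close>. \<open>S\<close> and \<open>T\<close> arise from \<open>NE_hor\<close>,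
    and \<open>N\<close> from \<open>NW_NW\<close>. Both sides turn out to be the sum of these six
    and one nested \<open>NW\<close> term.\<close>
  define N where "N = (\<Sum>i<n - 1. NW (us[i := ?c (us ! i)] @ [w]))"
  define P where "P = (\<Sum>j<n - 1. signed j (NE (us ! j # omit j us @ [hor (xs @ [w])])))"
  define Q where "Q = (\<Sum>j<n - 1. signed j (NE (vert (xs @ [us ! j]) # omit j us @ [w])))"
  define R where "R = (\<Sum>j<n - 1. \<Sum>i<n - 1 - 1. signed j (NE (us ! j # (omit j us)[i := ?c (omit j us ! i)] @ [w])))"
  define S where "S = (\<Sum>j<n - 1. signed j (NW (us @ [NE (xs ! j # omit j xs @ [w])])))"
  define T where "T = (\<Sum>j<n - 1. \<Sum>i<n - 1. signed (j + Suc i)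
      (NE (vert (us ! i # omit j xs @ [xs ! j]) # omit i us @ [w])))"
  have n2: "n - 1 - 1 = n - 2" by simp
  have "(\<Sum>j<n - 1. signed j (NW (xs @ [NE (us ! j # omit j us @ [w])]))) = P + Q + R"
    unfolding P_def Q_def R_def sum.distrib[symmetric] signed_sum[symmetric] signed_plus[symmetric] n2
    by (intro sum.cong refl arg_cong[where f = "signed _"] NW_NE) (use xs us in auto)
  then have 1: "NW (xs @ [hor (us @ [w])]) = NW (xs @ [NW (us @ [w])]) + (P + Q + R)"
    by (simp only: NW_hor[OF xs us])
  have 2: "(\<Sum>j<n - 1. signed j (NE (xs ! j # omit j xs @ [hor (us @ [w])]))) = S + T"
    unfolding S_def T_def sum.distrib[symmetric] signed_signed[symmetric] signed_sum[symmetric]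
      signed_plus[symmetric]
    by (intro sum.cong refl arg_cong[where f = "signed _"] NE_hor) (use xs us in auto)
  \<comment> \<open>Expanding the commutator in the vertical bracket yields \<open>Q\<close> as
    leading part and \<open>T\<close>, with the order of summation exchanged, as the rest.\<close>
  have 3: "(\<Sum>i<n - 1. signed i (NE (?c (us ! i) # omit i us @ [w]))) = Q + T"
  proof -
    have "T = (\<Sum>i<n - 1. \<Sum>j<n - 1. signed (i + Suc j)
        (NE (vert (us ! i # omit j xs @ [xs ! j]) # omit i us @ [w])))"
      unfolding T_def by (subst sum.swap) (intro sum.cong refl signed_cong, auto)
    then show ?thesis
      unfolding Q_def
      by (simp only: sum.distrib[symmetric] signed_signed[symmetric] signed_sum[symmetric]
        signed_plus[symmetric]) (intro sum.cong refl arg_cong[where f = "signed _"] NE_comm_snoc_first;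
        use xs us n in auto)
  qed
  have 4: "(\<Sum>i<n - 1. hor (us[i := ?c (us ! i)] @ [w])) = N + ((Q + T) + R)"
    using sum_update_omit[of "n - 1" us "\<lambda>j u zs. signed j (NE (u # zs @ [w]))" ?c] us 3
    by (simp add: hor_snoc sum.distrib N_def R_def)
  have 5: "hor (us @ [hor (xs @ [w])]) = NW (us @ [NW (xs @ [w])]) + S + P"
    unfolding hor_snoc[OF us, of "hor (xs @ [w])"] NW_hor[OF us xs] S_def P_def ..
  have 6: "NW (xs @ [NW (us @ [w])]) = NW (us @ [NW (xs @ [w])]) + N"
    unfolding N_def by (rule NW_NW[OF xs us])
  show ?thesis
    unfolding hor_snoc[OF xs, of "hor (us @ [w])"] 1 2 4 5 6 by (simp only: ac_simps)
qed

text \<open>\<open>hor_Cons\<close> sorts the left side by the slot of the commutator. The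
  \<open>NW\<close> slot gives \<open>P\<close>, the slot after the first of \<open>NE\<close> gives
  \<open>R\<close>. In the first slot of \<open>NE\<close> the commutator is expanded vertically;
  \<open>NE_vert\<close> then yields \<open>Q\<close> and a double sum that becomes \<open>S\<close>
  when the two omitted entries exchange roles.\<close>

lemma hor_comm:
  assumes xs: "length xs = n" and us: "length us = n - 2"
  shows "hor (comm xs # us @ [w])
    = (\<Sum>i<n. signed (n - Suc i) (hor (omit i xs @ [hor (xs ! i # us @ [w])])))"
proof -
  let ?H = "\<lambda>i. hor (xs ! i # us @ [w])"
  define P where "P = (\<Sum>i<n. signed (n - Suc i) (NW (omit i xs @ [NW (xs ! i # us @ [w])])))"
  define Q where "Q = (\<Sum>i<n. signed (n - Suc i) (NW (omit i xs @ [NE (xs ! i # us @ [w])])))"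
  define R where "R = (\<Sum>i<n. \<Sum>j<n - 2. signed (n - Suc i + Suc j)
    (NW (omit i xs @ [NE (us ! j # xs ! i # omit j us @ [w])])))"
  define S where "S = (\<Sum>i<n. \<Sum>k<n - 1. signed (n - Suc i + k)
    (NE (omit i xs ! k # omit k (omit i xs) @ [?H i])))"
  have "NW (omit i xs @ [?H i]) = NW (omit i xs @ [NW (xs ! i # us @ [w])])
      + NW (omit i xs @ [NE (xs ! i # us @ [w])])
      + (\<Sum>j<n - 2. signed (Suc j) (NW (omit i xs @ [NE (us ! j # xs ! i # omit j us @ [w])])))"
    if "i < n" for i
  proof -
    have l: "Vector_Spaces.linear scale scale (\<lambda>a. NW (omit i xs @ [a]))"
      by (rule linear_NW_last) (use that xs in simp)
    interpret l: Vector_Spaces.linear scale scale "\<lambda>a. NW (omit i xs @ [a])" by (rule l)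
    show ?thesis
      unfolding hor_Cons[OF us] l.add linear_signed_sum[OF l] ..
  qed
  then have "(\<Sum>i<n. signed (n - Suc i) (hor (omit i xs @ [?H i]))) = P + Q + R + S"
    using xs by (simp add: hor_snoc signed_plus signed_sum sum.distrib P_def Q_def R_def S_def)
  moreover have "NW (comm xs # us @ [w]) = P"
    unfolding P_def by (rule NW_comm) (use xs us n in auto)
  moreover have "NE (comm xs # us @ [w]) = Q + S"
  proof -
    have l: "Vector_Spaces.linear scale scale (\<lambda>a. NE (a # us @ [w]))"
      by (rule linear_NE_first) (use us n in simp)
    have "NE (comm xs # us @ [w])
      = (\<Sum>i<n. signed (n - Suc i) (NE (vert (omit i xs @ [xs ! i]) # us @ [w])))"
      unfolding comm_eq_vert[OF xs] by (rule linear_signed_sum[OF l])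
    also have "\<dots> = Q + (\<Sum>i<n. \<Sum>k<n - 1. signed (n - Suc i + Suc k)
        (NE (xs ! i # omit k (omit i xs) @ [hor (omit i xs ! k # us @ [w])])))"
      unfolding Q_def sum.distrib[symmetric] signed_signed[symmetric] signed_sum[symmetric]
        signed_plus[symmetric]
      by (intro sum.cong refl arg_cong[where f = "signed _"] NE_vert) (use xs us in auto)
    also have "\<dots> = Q + S"
      unfolding S_def
      using sum_omit_omit_swap_signed[OF xs, of "\<lambda>a b r. NE (a # r @ [hor (b # us @ [w])])"]
      by simp
    finally show ?thesis .
  qed
  \<comment> \<open>An index \<open>j < n - 2\<close> exists only for \<open>n \<ge> 3\<close>, as
    \<open>NE_comm\<close> requires.\<close>
  moreover have "(\<Sum>j<n - 2. signed (Suc j) (NE (us ! j # comm xs # omit j us @ [w]))) = R"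
  proof -
    have "R = (\<Sum>j<n - 2. \<Sum>i<n. signed (Suc j + (n - Suc i))
        (NW (omit i xs @ [NE (us ! j # xs ! i # omit j us @ [w])])))"
      unfolding R_def by (subst sum.swap) (simp only: add.commute)
    then show ?thesis
      unfolding signed_signed[symmetric] signed_sum[symmetric]
      by (simp only:) (intro sum.cong refl arg_cong[where f = "signed _"] NE_comm; use xs us in auto)
  qed
  ultimately show ?thesis
    unfolding hor_Cons[OF us] by (simp only: ac_simps)
qed

text \<open>The scheme of \<open>hor_hor\<close> with \<open>NE_vert\<close> in place of
  \<open>NE_hor\<close>. Now \<open>P\<close>, the part with the horizontal bracket in the last slot
  of \<open>NE\<close>, combines with \<open>T\<close> to a commutator, while \<open>Q\<close>
  belongs to the nested vertical bracket.\<close>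

lemma vert_vert:
  assumes xs: "length xs = n - 1" and us: "length us = n - 1"
  shows "vert (xs @ [vert (us @ [w])])
    = (\<Sum>i<n - 1. vert (us[i := comm (xs @ [us ! i])] @ [w])) + vert (us @ [vert (xs @ [w])])"
proof -
  let ?c = "\<lambda>u. comm (xs @ [u])"
  define N where "N = (\<Sum>i<n - 1. NW (us[i := ?c (us ! i)] @ [w]))"
  define P where "P = (\<Sum>j<n - 1. signed (Suc j) (NE (w # omit j us @ [hor (xs @ [us ! j])])))"
  define Q where "Q = (\<Sum>j<n - 1. signed (Suc j) (NE (vert (xs @ [w]) # omit j us @ [us ! j])))"
  define R where "R = (\<Sum>j<n - 1. \<Sum>i<n - 1 - 1.
    signed (Suc j) (NE (w # (omit j us)[i := ?c (omit j us ! i)] @ [us ! j])))"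
  define S where "S = (\<Sum>j<n - 1. signed (Suc j) (NW (us @ [NE (w # omit j xs @ [xs ! j])])))"
  define T where "T = (\<Sum>j<n - 1. \<Sum>i<n - 1. signed (Suc j + Suc i)
      (NE (w # omit i us @ [hor (us ! i # omit j xs @ [xs ! j])])))"
  have n2: "n - 1 - 1 = n - 2" by simp
  have "(\<Sum>j<n - 1. signed (Suc j) (NW (xs @ [NE (w # omit j us @ [us ! j])]))) = P + Q + R"
    unfolding P_def Q_def R_def sum.distrib[symmetric] signed_sum[symmetric] signed_plus[symmetric] n2
    by (intro sum.cong refl arg_cong[where f = "signed _"] NW_NE) (use xs us in auto)
  then have 1: "NW (xs @ [vert (us @ [w])]) = NW (xs @ [NW (us @ [w])]) + (P + Q + R)"
    by (simp only: NW_vert[OF xs us])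
  have 2: "(\<Sum>j<n - 1. signed (Suc j) (NE (vert (us @ [w]) # omit j xs @ [xs ! j]))) = S + T"
    unfolding S_def T_def sum.distrib[symmetric] signed_signed[symmetric] signed_sum[symmetric]
      signed_plus[symmetric]
    by (intro sum.cong refl arg_cong[where f = "signed _"] NE_vert) (use xs us in auto)
  have 3: "(\<Sum>i<n - 1. signed (Suc i) (NE (w # omit i us @ [?c (us ! i)]))) = P + T"
  proof -
    have "T = (\<Sum>i<n - 1. \<Sum>j<n - 1. signed (Suc i + Suc j)
        (NE (w # omit i us @ [hor (us ! i # omit j xs @ [xs ! j])])))"
      unfolding T_def by (subst sum.swap) (intro sum.cong refl signed_cong, auto)
    then show ?thesis
      unfolding P_def
      by (simp only: sum.distrib[symmetric] signed_signed[symmetric] signed_sum[symmetric]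
        signed_plus[symmetric]) (intro sum.cong refl arg_cong[where f = "signed _"] NE_comm_snoc_last;
        use xs us n in auto)
  qed
  have 4: "(\<Sum>i<n - 1. vert (us[i := ?c (us ! i)] @ [w])) = N + ((P + T) + R)"
    using sum_update_omit[of "n - 1" us "\<lambda>j u zs. signed (Suc j) (NE (w # zs @ [u]))" ?c] us 3
    by (simp add: vert_snoc sum.distrib N_def R_def)
  have 5: "vert (us @ [vert (xs @ [w])]) = NW (us @ [NW (xs @ [w])]) + S + Q"
    unfolding vert_snoc[OF us, of "vert (xs @ [w])"] NW_vert[OF us xs] S_def Q_def ..
  have 6: "NW (xs @ [NW (us @ [w])]) = NW (us @ [NW (xs @ [w])]) + N"
    unfolding N_def by (rule NW_NW[OF xs us])
  show ?thesis
    unfolding vert_snoc[OF xs, of "vert (us @ [w])"] 1 2 4 5 6 by (simp only: ac_simps)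
qed

text \<open>Here the commutator reaches the last slot of \<open>NE\<close>, with a minus sign from
  \<open>vert_Cons\<close>. It is expanded horizontally, and \<open>NE_hor\<close> followed by the
  exchange of omitted entries gives \<open>Q + S\<close>.\<close>

lemma vert_comm:
  assumes xs: "length xs = n" and us: "length us = n - 2"
  shows "vert (comm xs # us @ [w])
    = (\<Sum>i<n. signed (n - Suc i) (vert (omit i xs @ [vert (xs ! i # us @ [w])])))"
proof -
  let ?V = "\<lambda>i. vert (xs ! i # us @ [w])"
  define P where "P = (\<Sum>i<n. signed (n - Suc i) (NW (omit i xs @ [NW (xs ! i # us @ [w])])))"
  define Q where "Q = (\<Sum>i<n. signed (n - Suc i) (NW (omit i xs @ [NE (w # us @ [xs ! i])])))"
  define R where "R = (\<Sum>i<n. \<Sum>j<n - 2. signed (n - Suc i + j)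
    (NW (omit i xs @ [NE (w # xs ! i # omit j us @ [us ! j])])))"
  define S where "S = (\<Sum>i<n. \<Sum>k<n - 1. signed (n - Suc i + k)
    (NE (?V i # omit k (omit i xs) @ [omit i xs ! k])))"
  have "NW (omit i xs @ [?V i]) = NW (omit i xs @ [NW (xs ! i # us @ [w])])
      - NW (omit i xs @ [NE (w # us @ [xs ! i])])
      + (\<Sum>j<n - 2. signed j (NW (omit i xs @ [NE (w # xs ! i # omit j us @ [us ! j])])))"
    if "i < n" for i
  proof -
    have l: "Vector_Spaces.linear scale scale (\<lambda>a. NW (omit i xs @ [a]))"
      by (rule linear_NW_last) (use that xs in simp)
    interpret l: Vector_Spaces.linear scale scale "\<lambda>a. NW (omit i xs @ [a])" by (rule l)
    show ?thesis
      unfolding vert_Cons[OF us] l.add l.diff linear_signed_sum[OF l] ..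
  qed
  then have "(\<Sum>i<n. signed (n - Suc i) (vert (omit i xs @ [?V i]))) = P - Q + R - S"
    using xs by (simp add: vert_snoc signed_plus signed_sum sum.distrib P_def Q_def R_def S_def
        signed_Suc signed_minus diff_conv_add_uminus sum_negf del: add_uminus_conv_diff)
  moreover have "NW (comm xs # us @ [w]) = P"
    unfolding P_def by (rule NW_comm) (use xs us n in auto)
  moreover have "NE (w # us @ [comm xs]) = Q + S"
  proof -
    have "NE (w # us @ [comm xs])
      = (\<Sum>i<n. signed (n - Suc i) (NE (w # us @ [hor (omit i xs @ [xs ! i])])))"
      unfolding comm_eq_hor by (rule linear_signed_sum[OF linear_NE_last[OF us]])
    also have "\<dots> = Q + (\<Sum>i<n. \<Sum>k<n - 1. signed (n - Suc i + Suc k)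
        (NE (vert (omit i xs ! k # us @ [w]) # omit k (omit i xs) @ [xs ! i])))"
      unfolding Q_def sum.distrib[symmetric] signed_signed[symmetric] signed_sum[symmetric]
        signed_plus[symmetric]
      by (intro sum.cong refl arg_cong[where f = "signed _"] NE_hor) (use xs us in auto)
    also have "\<dots> = Q + S"
      unfolding S_def
      using sum_omit_omit_swap_signed[OF xs, of "\<lambda>a b r. NE (vert (b # us @ [w]) # r @ [a])"]
      by simp
    finally show ?thesis .
  qed
  moreover have "(\<Sum>j<n - 2. signed j (NE (w # comm xs # omit j us @ [us ! j]))) = R"
  proof -
    have "R = (\<Sum>j<n - 2. \<Sum>i<n. signed (j + (n - Suc i))
        (NW (omit i xs @ [NE (w # xs ! i # omit j us @ [us ! j])])))"
      unfolding R_def by (subst sum.swap) (simp only: add.commute)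
    then show ?thesis
      unfolding signed_signed[symmetric] signed_sum[symmetric]
      by (simp only:) (intro sum.cong refl arg_cong[where f = "signed _"] NE_comm; use xs us in auto)
  qed
  ultimately show ?thesis
    unfolding vert_Cons[OF us] by (simp add: algebra_simps)
qed

lemma n_pre_lie_hor: "n_pre_lie n scale hor"
  unfolding n_pre_lie_def
proof (intro conjI allI impI)
  fix xs ys :: "'b list"
  assume xs: "length xs = n - 1" and "length ys = n"
  then obtain us w where "ys = us @ [w]" "length us = n - 1"
    using n by (cases ys rule: rev_cases) auto
  then show "hor (xs @ [hor ys]) = (\<Sum>i<n - 1. hor (ys[i := sub_adjacent n scale hor (xs @ [ys ! i])]))
      + hor (butlast ys @ [hor (xs @ [last ys])])"
    using hor_hor[OF xs, of us w]
    by (simp add: dend_comm_def[symmetric] list_update_append nth_append)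
next
  fix xs ys :: "'b list"
  assume xs: "length xs = n" and "length ys = n - 1"
  then obtain us w where "ys = us @ [w]" "length us = n - 2"
    using n by (cases ys rule: rev_cases) auto
  then show "hor (sub_adjacent n scale hor xs # ys)
      = (\<Sum>i<n. (-1) ^ (n - Suc i) *s hor (omit i xs @ [hor (xs ! i # ys)]))"
    using hor_comm[OF xs, of us w] by (simp add: dend_comm_def[symmetric] scale_neg_one_power)
qed (rule multilinear_hor skew_hor)+

lemma n_pre_lie_vert: "n_pre_lie n scale vert"
  unfolding n_pre_lie_def
proof (intro conjI allI impI)
  fix xs ys :: "'b list"
  assume xs: "length xs = n - 1" and "length ys = n"
  then obtain us w where "ys = us @ [w]" "length us = n - 1"
    using n by (cases ys rule: rev_cases) auto
  then show "vert (xs @ [vert ys]) = (\<Sum>i<n - 1. vert (ys[i := sub_adjacent n scale vert (xs @ [ys ! i])]))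
      + vert (butlast ys @ [vert (xs @ [last ys])])"
    using vert_vert[OF xs, of us w] xs n
    by (simp add: sub_adjacent_vert list_update_append nth_append)
next
  fix xs ys :: "'b list"
  assume xs: "length xs = n" and "length ys = n - 1"
  then obtain us w where "ys = us @ [w]" "length us = n - 2"
    using n by (cases ys rule: rev_cases) auto
  then show "vert (sub_adjacent n scale vert xs # ys)
      = (\<Sum>i<n. (-1) ^ (n - Suc i) *s vert (omit i xs @ [vert (xs ! i # ys)]))"
    using vert_comm[OF xs, of us w] xs by (simp add: sub_adjacent_vert scale_neg_one_power)
qed (rule multilinear_vert skew_vert)+

section \<open>Representations of the associated n-Lie algebra\<close>

lemma n_lie_rep_NW: "n_lie_rep n scale comm scale (left_mult NW)"
  unfolding n_lie_rep_def
proof (intro conjI allI impI)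
  show "n_lie n scale comm"
    unfolding dend_comm_def using n_pre_lie_imp_n_lie[OF n_pre_lie_hor] n by simp
  show "skew_operator_map scale scale {..<n - 1} (n - 1) (left_mult NW)"
    using skew_operator_map_left_mult[OF multilinear_NW skew_NW] n by simp
  show "left_mult NW (comm xs # ys) v
      = (\<Sum>i<n. (-1) ^ (n - Suc i) *s left_mult NW (omit i xs) (left_mult NW (xs ! i # ys) v))"
    if "length xs = n" "length ys = n - 2" for xs ys v
    using NW_comm[of xs "ys @ [v]"] that n by (simp add: left_mult_def scale_neg_one_power)
  show "left_mult NW xs (left_mult NW ys v) - left_mult NW ys (left_mult NW xs v)
      = (\<Sum>i<n - 1. left_mult NW (ys[i := comm (xs @ [ys ! i])]) v)"
    if "length xs = n - 1" "length ys = n - 1" for xs ys v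
    using NW_NW[of xs ys v] that by (simp add: left_mult_def)
qed

lemma n_lie_rep_rho: "n_lie_rep n scale comm scale (dend_rho n scale NW NE)"
proof (rule n_lie_rep_cong[OF n_pre_lie_left_mult_rep[OF n_pre_lie_vert n] n])
  show "dend_rho n scale NW NE xs v = left_mult vert xs v" if "length xs = n - 1" for xs v
    using that by (simp add: dend_rho_def left_mult_def vert_snoc scale_neg_one_power del: power_Suc)
qed (simp add: sub_adjacent_vert)

section \<open>The right actions and the associated operators mu\<close>

lemma skew_operator_map_right_mult_NE:
  "skew_operator_map scale scale {..<n - 2} (n - 1) (right_mult NE)"
  unfolding skew_operator_map_def right_mult_def
proof (intro conjI allI impI)
  show "Vector_Spaces.linear scale scale (\<lambda>v. NE (v # xs))" if "length xs = n - 1" for xs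
    by (rule linear_NE_first[OF that])
  show "multilinear scale scale (n - 1) (\<lambda>xs. NE (v # xs))" for v
    unfolding multilinear_def
  proof (intro allI impI)
    fix xs :: "'b list" and i
    assume "length xs = n - 1" "i < n - 1"
    then show "Vector_Spaces.linear scale scale (\<lambda>a. NE (v # xs[i := a]))"
      using multilinear_NE[unfolded multilinear_def, rule_format, of "v # xs" "Suc i"] n by simp
  qed
  show "skew_in {..<n - 2} (n - 1) (\<lambda>xs. NE (v # xs))" for v
    unfolding skew_in_def
  proof (intro allI impI ballI)
    fix xs :: "'b list" and i j
    assume "length xs = n - 1" "i \<in> {..<n - 2}" "j \<in> {..<n - 2}" "i \<noteq> j"
    then show "NE (v # xs[i := xs ! j, j := xs ! i]) = - NE (v # xs)"
      using skew_NE[unfolded skew_in_def, rule_format, of "v # xs" "Suc i" "Suc j"] n by simp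
  qed
qed

lemma skew_operator_map_left_mult_NE:
  "skew_operator_map scale scale {..<n - 2} (n - 1) (\<lambda>xs v. - left_mult NE (last_to_front xs) v)"
  unfolding skew_operator_map_def left_mult_def last_to_front_def
proof (intro conjI allI impI)
  interpret vector_space_pair scale scale by unfold_locales
  show "Vector_Spaces.linear scale scale (\<lambda>v. - NE ((last xs # butlast xs) @ [v]))"
    if "length xs = n - 1" for xs
    using linear_compose_neg[OF linear_NE_last[of "butlast xs" "last xs"]] that n by simp
  show "multilinear scale scale (n - 1) (\<lambda>xs. - NE ((last xs # butlast xs) @ [v]))" for v
    unfolding multilinear_def
  proof (intro allI impI linear_compose_neg)
    fix xs :: "'b list" and i
    assume "length xs = n - 1" "i < n - 1"
    then obtain us w where xs: "xs = us @ [w]" "length us = n - 2"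
      using n by (cases xs rule: rev_cases) auto
    show "Vector_Spaces.linear scale scale
        (\<lambda>a. NE ((last (xs[i := a]) # butlast (xs[i := a])) @ [v]))"
    \<comment> \<open>Bringing the last entry to the front sends slot \<open>i < n - 2\<close> to
      slot \<open>Suc i\<close> of \<open>NE\<close>, and the last slot to slot 0.\<close>
    proof (cases "i < n - 2")
      case True
      then show ?thesis
        using multilinear_NE[unfolded multilinear_def, rule_format, of "w # us @ [v]" "Suc i"] n xs
        by (simp add: list_update_append)
    next
      case False
      then have "i = length us" using \<open>i < n - 1\<close> xs(2) by simp
      then have "last (xs[i := a]) # butlast (xs[i := a]) = a # us" for a
        by (simp add: xs(1))
      then show ?thesis
        using linear_NE_first[of "us @ [v]"] n xs(2) by simp
    qed
  qed
  show "skew_in {..<n - 2} (n - 1) (\<lambda>xs. - NE ((last xs # butlast xs) @ [v]))" for v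
    unfolding skew_in_def
  proof (intro allI impI ballI)
    fix xs :: "'b list" and i j
    assume "length xs = n - 1" and ij: "i \<in> {..<n - 2}" "j \<in> {..<n - 2}" "i \<noteq> j"
    then obtain us w where xs: "xs = us @ [w]" "length us = n - 2"
      using n by (cases xs rule: rev_cases) auto
    then show "- NE ((last (xs[i := xs ! j, j := xs ! i]) # butlast (xs[i := xs ! j, j := xs ! i])) @ [v])
        = - (- NE ((last xs # butlast xs) @ [v]))"
      using skew_NE[unfolded skew_in_def, rule_format, of "w # us @ [v]" "Suc i" "Suc j"] n ij
      by (simp add: list_update_append nth_append)
  qed
qed

lemma pre_lie_mu_hor:
  "length xs = n - 1 \<Longrightarrow> pre_lie_mu n scale (left_mult NW) (right_mult NE) xs v = vert (xs @ [v])"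
  by (simp add: pre_lie_mu_def left_mult_def right_mult_def vert_snoc scale_neg_one_power del: power_Suc)

text \<open>\<open>last_to_front\<close> returns the omitted entry to the front of
  \<open>NE\<close>, and the minus sign of the right action turns (-1)^(i+1) into the sign of the
  horizontal bracket.\<close>

lemma pre_lie_mu_vert:
  assumes "length xs = n - 1"
  shows "pre_lie_mu n scale (left_mult NW) (\<lambda>xs v. - left_mult NE (last_to_front xs) v) xs v
    = hor (xs @ [v])"
  using assms
  by (simp add: pre_lie_mu_def left_mult_def last_to_front_def hor_snoc scale_neg_one_power
      signed_Suc signed_minus del: power_Suc)

section \<open>Representations of the two n-pre-Lie algebras\<close>

lemma n_pre_lie_rep_hor: "n_pre_lie_rep n scale hor scale (left_mult NW) (right_mult NE)"
  unfolding n_pre_lie_rep_def dend_comm_def[symmetric]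
proof (intro conjI allI impI)
  show "n_pre_lie n scale hor" by (rule n_pre_lie_hor)
  show "n_lie_rep n scale comm scale (left_mult NW)" by (rule n_lie_rep_NW)
  show "skew_operator_map scale scale {..<n - 2} (n - 1) (right_mult NE)"
    by (rule skew_operator_map_right_mult_NE)
next
  fix xs ys :: "'b list" and v
  assume xs: "length xs = n - 1" and "length ys = n - 1"
  then obtain us w where "ys = us @ [w]" "length us = n - 2"
    using n by (cases ys rule: rev_cases) auto
  then show "left_mult NW xs (right_mult NE ys v)
      = right_mult NE ys (pre_lie_mu n scale (left_mult NW) (right_mult NE) xs v)
        + (\<Sum>i<n - 2. right_mult NE (ys[i := comm (xs @ [ys ! i])]) v)
        + right_mult NE (butlast ys @ [hor (xs @ [last ys])]) v"
    using NW_NE[OF xs, of us v w]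
    by (simp add: pre_lie_mu_hor[OF xs] left_mult_def right_mult_def list_update_append nth_append
        algebra_simps)
next
  fix xs ys :: "'b list" and v
  assume "n \<ge> 3" "length xs = n" "length ys = n - 2"
  then show "right_mult NE (comm xs # ys) v
      = (\<Sum>i<n. (-1) ^ (n - Suc i) *s left_mult NW (omit i xs) (right_mult NE (xs ! i # ys) v))"
    using NE_comm[of xs ys v] by (simp add: left_mult_def right_mult_def scale_neg_one_power)
next
  fix xs ys :: "'b list" and v
  assume xs: "length xs = n - 2" and ys: "length ys = n"
  \<comment> \<open>The axiom is taken in its original form, whose argument order and sign
    (-1)^(n+i) are those of the representation condition; \<open>NE_hor\<close> has already moved
    \<open>ys ! i\<close>.\<close>
  have "\<forall>xs ys z. length xs = n - 2 \<longrightarrow> length ys = n \<longrightarrow>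
        NE (z # xs @ [hor ys]) - NW (butlast ys @ [NE (z # xs @ [last ys])]) =
          (\<Sum>i<n - 1. (-1) ^ (n + Suc i) *s NE (vert (xs @ [ys ! i, z]) # omit i ys))"
    using dendriform unfolding n_L_dendriform_def by blast
  from this[rule_format, OF xs ys, of v]
  show "right_mult NE (xs @ [hor ys]) v
      = left_mult NW (butlast ys) (right_mult NE (xs @ [last ys]) v)
        + (\<Sum>i<n - 1. (-1) ^ (n + Suc i) *s
            right_mult NE (omit i ys) (pre_lie_mu n scale (left_mult NW) (right_mult NE) (xs @ [ys ! i]) v))"
    using xs n
    by (simp add: left_mult_def right_mult_def pre_lie_mu_hor diff_eq_eq add.commute
        del: power_Suc power_add)
next
  fix xs ys :: "'b list" and v
  assume xs: "length xs = n - 1" and "length ys = n - 1"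
  then obtain us w where "ys = us @ [w]" "length us = n - 2"
    using n by (cases ys rule: rev_cases) auto
  then show "right_mult NE ys (pre_lie_mu n scale (left_mult NW) (right_mult NE) xs v)
      = left_mult NW xs (right_mult NE ys v)
        + (\<Sum>i<n - 1. (-1) ^ Suc i *s right_mult NE (omit i xs @ [hor (xs ! i # ys)]) v)"
    using NE_vert[OF xs, of us v w]
    by (simp add: pre_lie_mu_hor[OF xs] left_mult_def right_mult_def scale_neg_one_power del: power_Suc)
qed

text \<open>Compared with the horizontal case, \<open>NE_vert\<close> and \<open>NE_hor\<close>
  change places: the former gives the condition on a bracket in the last argument of the right
  action, the latter the condition on the right action composed with mu.\<close>

lemma n_pre_lie_rep_vert:
  "n_pre_lie_rep n scale vert scale (left_mult NW) (\<lambda>xs v. - left_mult NE (last_to_front xs) v)"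
  (is "n_pre_lie_rep _ _ _ _ _ ?r")
  unfolding n_pre_lie_rep_def
proof (intro conjI allI impI)
  show "n_pre_lie n scale vert" by (rule n_pre_lie_vert)
  show "n_lie_rep n scale (sub_adjacent n scale vert) scale (left_mult NW)"
    by (rule n_lie_rep_cong[OF n_lie_rep_NW n]) (simp_all add: sub_adjacent_vert)
  show "skew_operator_map scale scale {..<n - 2} (n - 1) ?r"
    by (rule skew_operator_map_left_mult_NE)
next
  fix xs ys :: "'b list" and v
  assume xs: "length xs = n - 1" and "length ys = n - 1"
  then obtain us w where ys: "ys = us @ [w]" "length us = n - 2"
    using n by (cases ys rule: rev_cases) auto
  interpret l: Vector_Spaces.linear scale scale "\<lambda>a. NW (xs @ [a])"
    by (rule linear_NW_last[OF xs])
  show "left_mult NW xs (?r ys v)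
      = ?r ys (pre_lie_mu n scale (left_mult NW) ?r xs v)
        + (\<Sum>i<n - 2. ?r (ys[i := sub_adjacent n scale vert (xs @ [ys ! i])]) v)
        + ?r (butlast ys @ [vert (xs @ [last ys])]) v"
    unfolding pre_lie_mu_vert[OF xs]
    using NW_NE[OF xs ys(2), of w v] ys xs n
    by (simp add: left_mult_def last_to_front_def list_update_append nth_append
        butlast_append sub_adjacent_vert l.neg sum_negf algebra_simps)
next
  fix xs ys :: "'b list" and v
  assume n3: "n \<ge> 3" and xs: "length xs = n" and "length ys = n - 2"
  then obtain us w where ys: "ys = us @ [w]" "length us = n - 3"
    by (cases ys rule: rev_cases) auto
  \<comment> \<open>Since \<open>ys\<close> is nonempty for \<open>n \<ge> 3\<close>, its last entry
    \<open>w\<close> goes to the front of \<open>NE\<close>, and the commutator lands in the slot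
    where \<open>NE_comm\<close> expects it.\<close>
  have "- NE (w # comm xs # us @ [v])
    = (\<Sum>i<n. signed (n - Suc i) (NW (omit i xs @ [- NE (w # xs ! i # us @ [v])])))"
  proof -
    have "NW (omit i xs @ [- a]) = - NW (omit i xs @ [a])" if "i < n" for i a
    proof -
      interpret l: Vector_Spaces.linear scale scale "\<lambda>a. NW (omit i xs @ [a])"
        by (rule linear_NW_last) (use that xs in simp)
      show ?thesis by (rule l.neg)
    qed
    then show ?thesis
      using NE_comm[OF n3 xs, of "us @ [v]" w] ys n3 by (simp add: signed_minus sum_negf)
  qed
  then show "?r (sub_adjacent n scale vert xs # ys) v
      = (\<Sum>i<n. (-1) ^ (n - Suc i) *s left_mult NW (omit i xs) (?r (xs ! i # ys) v))"
    using xs ys by (simp add: sub_adjacent_vert left_mult_def last_to_front_def scale_neg_one_power)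
next
  fix xs ys :: "'b list" and v
  assume xs: "length xs = n - 2" and "length ys = n"
  then obtain us w where ys: "ys = us @ [w]" "length us = n - 1"
    using n by (cases ys rule: rev_cases) auto
  interpret l: Vector_Spaces.linear scale scale "\<lambda>a. NW (us @ [a])"
    by (rule linear_NW_last[OF ys(2)])
  \<comment> \<open>The representation condition has \<open>us ! i\<close> behind \<open>xs\<close>;
    moving it there from the front past \<open>n - 2\<close> skew arguments accounts for the factor
    (-1)^n.\<close>
  have "signed (Suc i) (NE (w # omit i us @ [hor (us ! i # xs @ [v])]))
      = signed (n + Suc i) (NE (w # omit i us @ [hor (xs @ [us ! i, v])]))" if "i < n - 1" for i
  proof -
    have "hor (us ! i # xs @ [v]) = signed n (hor (xs @ [us ! i, v]))"
      using skew_in_move[of 0 "n - 1" n hor "[]" xs "[v]" "us ! i"] skew_hor xs n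
      by (auto simp: lessThan_atLeast0 intro!: signed_cong)
    then show ?thesis
      using linear_signed[OF linear_NE_last, of "omit i us" w n] ys that by (simp add: add.commute)
  qed
  moreover have "pre_lie_mu n scale (left_mult NW) ?r (xs @ [a]) v = hor (xs @ [a, v])" for a
    using pre_lie_mu_vert[of "xs @ [a]" v] xs n by simp
  ultimately show "?r (xs @ [vert ys]) v
      = left_mult NW (butlast ys) (?r (xs @ [last ys]) v)
        + (\<Sum>i<n - 1. (-1) ^ (n + Suc i) *s
            ?r (omit i ys) (pre_lie_mu n scale (left_mult NW) ?r (xs @ [ys ! i]) v))"
    using NE_vert[OF ys(2) xs, of w v] xs ys n
    by (simp add: left_mult_def last_to_front_def nth_append butlast_append
        scale_neg_one_power signed_minus sum_negf l.neg del: power_Suc)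
next
  fix xs ys :: "'b list" and v
  assume xs: "length xs = n - 1" and "length ys = n - 1"
  then obtain us w where ys: "ys = us @ [w]" "length us = n - 2"
    using n by (cases ys rule: rev_cases) auto
  interpret l: Vector_Spaces.linear scale scale "\<lambda>a. NW (xs @ [a])"
    by (rule linear_NW_last[OF xs])
  show "?r ys (pre_lie_mu n scale (left_mult NW) ?r xs v)
      = left_mult NW xs (?r ys v)
        + (\<Sum>i<n - 1. (-1) ^ Suc i *s ?r (omit i xs @ [vert (xs ! i # ys)]) v)"
    unfolding pre_lie_mu_vert[OF xs]
    using NE_hor[OF ys(2) xs, of w v] xs ys n
    by (simp add: left_mult_def last_to_front_def scale_neg_one_power
        signed_minus sum_negf l.neg del: power_Suc)
qed

end

theorem proposition5p3:
  fixes s :: "'k::field_char_0 \<Rightarrow> 'a::ab_group_add \<Rightarrow> 'a"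
    and Basis :: "'a set"
    and n :: nat
    and NW NE :: "'a list \<Rightarrow> 'a"
  assumes "finite_dimensional_vector_space s Basis"
    and "n \<ge> 2"
    and "n_L_dendriform n s NW NE"
  shows "n_pre_lie_rep n s (horizontal n s NW NE) s (left_mult NW) (right_mult NE)
       \<and> n_pre_lie_rep n s (vertical n s NW NE) s (left_mult NW)
           (\<lambda>xs v. - left_mult NE (last_to_front xs) v)
       \<and> n_lie_rep n s (dend_comm n s NW NE) s (left_mult NW)
       \<and> n_lie_rep n s (dend_comm n s NW NE) s (dend_rho n s NW NE)"
proof -
  interpret L_dendriform_space s n NW NE
    using assms
    by (simp add: L_dendriform_space_def L_dendriform_space_axioms_def
        finite_dimensional_vector_space_def)
  show ?thesis
    using n_pre_lie_rep_hor n_pre_lie_rep_vert n_lie_rep_NW n_lie_rep_rho by blast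
qed

end
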